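(* A bounded linear operator $X$ on $H^2$ satisfies $SX=X^*S$ if and only if $$X=U^*\begin{pmatrix} T^*_{\phi_{22}} & T_{\overline f+zf}\\ 0 & T_{\phi_{22}}\end{pmatrix}U$$ for some $\phi_{22}\in H^\infty$ and some $f\in H^2$ with $\overline f+zf\in L^\infty$.
   Context: $L^2,L^\infty$ are the square-integrable and essentially bounded functions on the unit circle $\mathbb{T}$; $H^2$ is the Hardy space, identified via boundary values with the closed subspace of $L^2$ of functions with vanishing negative Fourier coefficients; $H^\infty=L^\infty\cap H^2$; $P$ is the orthogonal projection of $L^2$ onto $H^2$. For $\phi\in L^\infty$, $T_\phi:H^2\to H^2$ is the Toeplitz operator $T_\phi h=P(\phi h)$. $S=T_z$ is the unilateral shift on $H^2$. Every $f(z)=\sum_{n\ge0}a_nz^n\in H^2$ is written uniquely as $f(z)=f_2(z^2)+zf_1(z^2)$ with $f_2(z)=\sum_{n\ge0}a_{2n}z^n$ and $f_1(z)=\sum_{n\ge0}a_{2n+1}z^n$; $U:H^2\to H^2\oplus H^2$ is the unitary $U(f)=(f_2,f_1)$. The function $\overline f+zf$ is understood as a function on $\mathbb{T}$. The block matrix acts on $H^2\oplus H^2$. *)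

theory Defs
  imports "HOL-Analysis.Analysis"
begin

section \<open>Complex inner product spaces\<close>

text \<open>The complex inner product is linear in the first argument; its real part is the
  \<open>inner\<close> of \<open>real_inner\<close>, so norm and topology are the library's.\<close>

class complex_inner = real_inner +
  fixes scaleC :: "complex \<Rightarrow> 'a \<Rightarrow> 'a" (infixr "*\<^sub>C" 75)
    and cinner :: "'a \<Rightarrow> 'a \<Rightarrow> complex"
  assumes scaleC_of_real: "complex_of_real r *\<^sub>C x = r *\<^sub>R x"
    and scaleC_add_right: "a *\<^sub>C (x + y) = a *\<^sub>C x + a *\<^sub>C y"
    and scaleC_add_left: "(a + b) *\<^sub>C x = a *\<^sub>C x + b *\<^sub>C x"
    and scaleC_scaleC: "a *\<^sub>C (b *\<^sub>C x) = (a * b) *\<^sub>C x"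
    and cinner_add_left: "cinner (x + y) z = cinner x z + cinner y z"
    and cinner_scaleC_left: "cinner (a *\<^sub>C x) y = a * cinner x y"
    and cinner_commute: "cinner x y = cnj (cinner y x)"
    and Re_cinner: "Re (cinner x y) = inner x y"

definition bounded_clinear :: "('a::complex_inner \<Rightarrow> 'b::complex_inner) \<Rightarrow> bool" where
  "bounded_clinear A \<longleftrightarrow> bounded_linear A \<and> (\<forall>c x. A (c *\<^sub>C x) = c *\<^sub>C A x)"

text \<open>As for \<open>adjoint\<close> in the library, the adjoint is a choice; it is unique whenever it
  exists, and it exists for bounded operators between Hilbert spaces.\<close>

definition cadjoint :: "('a::complex_inner \<Rightarrow> 'b::complex_inner) \<Rightarrow> 'b \<Rightarrow> 'a" where
  "cadjoint A = (SOME B. \<forall>x y. cinner (A x) y = cinner x (B y))"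

instantiation prod :: (complex_inner, complex_inner) complex_inner
begin

definition scaleC_prod_def: "c *\<^sub>C p = (c *\<^sub>C fst p, c *\<^sub>C snd p)"

definition cinner_prod_def: "cinner p q = cinner (fst p) (fst q) + cinner (snd p) (snd q)"

instance
proof
  fix a b :: complex and r :: real and x y z :: "'a \<times> 'b"
  show "complex_of_real r *\<^sub>C x = r *\<^sub>R x"
    by (simp add: scaleC_prod_def scaleC_of_real scaleR_prod_def)
  show "a *\<^sub>C (x + y) = a *\<^sub>C x + a *\<^sub>C y"
    by (simp add: scaleC_prod_def scaleC_add_right)
  show "(a + b) *\<^sub>C x = a *\<^sub>C x + b *\<^sub>C x"
    by (simp add: scaleC_prod_def scaleC_add_left)
  show "a *\<^sub>C (b *\<^sub>C x) = (a * b) *\<^sub>C x"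
    by (simp add: scaleC_prod_def scaleC_scaleC)
  show "cinner (x + y) z = cinner x z + cinner y z"
    by (simp add: cinner_prod_def cinner_add_left)
  show "cinner (a *\<^sub>C x) y = a * cinner x y"
    by (simp add: cinner_prod_def scaleC_prod_def cinner_scaleC_left distrib_left)
  show "cinner x y = cnj (cinner y x)"
    by (simp add: cinner_prod_def cinner_commute[symmetric])
  show "Re (cinner x y) = inner x y"
    by (simp add: cinner_prod_def inner_prod_def Re_cinner)
qed

end

text \<open>The operator with block matrix \<open>A B / C D\<close> (rows) on a direct sum.\<close>

definition block_op ::
  "('a \<Rightarrow> 'a) \<Rightarrow> ('b \<Rightarrow> 'a) \<Rightarrow> ('a \<Rightarrow> 'b) \<Rightarrow> ('b \<Rightarrow> 'b) \<Rightarrow> 'a \<times> 'b \<Rightarrow> 'a::plus \<times> 'b::plus" where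
  "block_op A B C D = (\<lambda>(x, y). (A x + B y, C x + D y))"

section \<open>The space \<open>L\<^sup>2\<close> of the unit circle\<close>

text \<open>Normalised arc length, as a Borel measure on the plane concentrated on the unit circle.
  Points off the circle form a null set, so functions on the circle are represented by
  functions on the plane, identified if they agree almost everywhere.\<close>

definition circle_measure :: "complex measure" where
  "circle_measure = distr (uniform_measure lborel {0..<2 * pi}) borel cis"

definition square_integrable :: "(complex \<Rightarrow> complex) \<Rightarrow> bool" where
  "square_integrable f \<longleftrightarrow> f \<in> borel_measurable circle_measure \<and>
     integrable circle_measure (\<lambda>w. (cmod (f w))\<^sup>2)"

lemma sets_circle_measure [simp, measurable_cong]: "sets circle_measure = sets borel"
  by (simp add: circle_measure_def)

lemma space_circle_measure [simp]: "space circle_measure = UNIV"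
  by (simp add: circle_measure_def)

lemma measurable_cis [measurable]: "cis \<in> borel_measurable borel"
  by (intro borel_measurable_continuous_onI continuous_intros)

lemma measurable_cnj [measurable]: "cnj \<in> borel_measurable borel"
  by (intro borel_measurable_continuous_onI continuous_intros)

lemma emeasure_uniform_UNIV: "emeasure (uniform_measure lborel {0..<2 * pi}) UNIV = 1"
proof -
  have "emeasure lborel {0..<2 * pi} = ennreal (2 * pi)"
    by simp
  then show ?thesis
    by (subst emeasure_uniform_measure) (auto intro!: divide_eq_1_ennreal simp: divide_ennreal)
qed

lemma emeasure_circle_measure_UNIV: "emeasure circle_measure UNIV = 1"
proof -
  have "emeasure circle_measure UNIV = emeasure (uniform_measure lborel {0..<2 * pi}) UNIV"
    unfolding circle_measure_def by (subst emeasure_distr) auto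
  then show ?thesis by (simp only: emeasure_uniform_UNIV)
qed

lemma AE_circle_measure_norm: "AE w in circle_measure. cmod w = 1"
  unfolding circle_measure_def by (subst AE_distr_iff) auto

interpretation circle: finite_measure circle_measure
  by standard (simp add: emeasure_circle_measure_UNIV)

lemma square_integrable_measurable:
  "square_integrable f \<Longrightarrow> f \<in> borel_measurable circle_measure"
  by (simp add: square_integrable_def)

lemma square_integrable_zero: "square_integrable (\<lambda>_. 0)"
  by (simp add: square_integrable_def)

lemma square_integrable_add:
  assumes "square_integrable f" "square_integrable g"
  shows "square_integrable (\<lambda>w. f w + g w)"
proof -
  have m [measurable]: "f \<in> borel_measurable circle_measure" "g \<in> borel_measurable circle_measure"
    using assms by (auto simp: square_integrable_def)
  have "integrable circle_measure (\<lambda>w. (cmod (f w + g w))\<^sup>2)"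
  proof (rule Bochner_Integration.integrable_bound)
    show "integrable circle_measure (\<lambda>w. 2 * (cmod (f w))\<^sup>2 + 2 * (cmod (g w))\<^sup>2)"
      using assms by (auto simp: square_integrable_def)
    show "AE w in circle_measure. norm ((cmod (f w + g w))\<^sup>2)
            \<le> norm (2 * (cmod (f w))\<^sup>2 + 2 * (cmod (g w))\<^sup>2)"
    proof (rule AE_I2)
      fix w
      have "(cmod (f w + g w))\<^sup>2 \<le> (cmod (f w) + cmod (g w))\<^sup>2"
        by (intro power_mono norm_triangle_ineq) simp
      also have "\<dots> \<le> 2 * (cmod (f w))\<^sup>2 + 2 * (cmod (g w))\<^sup>2"
        using sum_squares_bound[of "cmod (f w)" "cmod (g w)"]
        by (simp add: power2_eq_square algebra_simps)
      finally show "norm ((cmod (f w + g w))\<^sup>2) \<le> norm (2 * (cmod (f w))\<^sup>2 + 2 * (cmod (g w))\<^sup>2)"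
        by simp
    qed
  qed measurable
  then show ?thesis by (simp add: square_integrable_def)
qed

lemma square_integrable_scale:
  assumes "square_integrable f"
  shows "square_integrable (\<lambda>w. c * f w)"
  using assms by (auto simp: square_integrable_def norm_mult power_mult_distrib)

lemma square_integrable_cnj:
  assumes "square_integrable f"
  shows "square_integrable (\<lambda>w. cnj (f w))"
proof -
  have [measurable]: "f \<in> borel_measurable circle_measure"
    using assms by (rule square_integrable_measurable)
  have "(\<lambda>w. cnj (f w)) \<in> borel_measurable circle_measure"
    by measurable
  then show ?thesis
    using assms by (simp add: square_integrable_def)
qed

lemma square_integrable_uminus:
  assumes "square_integrable f"
  shows "square_integrable (\<lambda>w. - f w)"
  using assms by (auto simp: square_integrable_def)

lemma integrable_mult_cnj:
  assumes "square_integrable f" "square_integrable g"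
  shows "integrable circle_measure (\<lambda>w. f w * cnj (g w))"
proof -
  have m [measurable]: "f \<in> borel_measurable circle_measure" "g \<in> borel_measurable circle_measure"
    using assms by (auto simp: square_integrable_def)
  show ?thesis
  proof (rule Bochner_Integration.integrable_bound)
    show "integrable circle_measure (\<lambda>w. (cmod (f w))\<^sup>2 + (cmod (g w))\<^sup>2)"
      using assms by (auto simp: square_integrable_def)
    show "AE w in circle_measure. norm (f w * cnj (g w))
            \<le> norm ((cmod (f w))\<^sup>2 + (cmod (g w))\<^sup>2)"
    proof (rule AE_I2)
      fix w
      have "2 * (cmod (f w) * cmod (g w)) \<le> (cmod (f w))\<^sup>2 + (cmod (g w))\<^sup>2"
        using sum_squares_bound[of "cmod (f w)" "cmod (g w)"] by simp
      moreover have "0 \<le> cmod (f w) * cmod (g w)" by simp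
      ultimately have "cmod (f w) * cmod (g w) \<le> (cmod (f w))\<^sup>2 + (cmod (g w))\<^sup>2"
        by linarith
      then show "norm (f w * cnj (g w)) \<le> norm ((cmod (f w))\<^sup>2 + (cmod (g w))\<^sup>2)"
        by (simp add: norm_mult)
    qed
  qed measurable
qed

definition L2_rel :: "(complex \<Rightarrow> complex) \<Rightarrow> (complex \<Rightarrow> complex) \<Rightarrow> bool" where
  "L2_rel f g \<longleftrightarrow> square_integrable f \<and> square_integrable g \<and>
     (AE w in circle_measure. f w = g w)"

quotient_type L2 = "complex \<Rightarrow> complex" / partial: L2_rel
proof (rule part_equivpI)
  show "\<exists>f. L2_rel f f"
    using square_integrable_zero by (auto simp: L2_rel_def)
  show "symp L2_rel"
    by (auto simp: symp_def L2_rel_def)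
  show "transp L2_rel"
    unfolding transp_def L2_rel_def by (auto elim: AE_mp intro: AE_I2)
qed

instantiation L2 :: complex_inner
begin

lift_definition zero_L2 :: L2 is "\<lambda>_. 0"
  by (simp add: L2_rel_def square_integrable_zero)

lift_definition plus_L2 :: "L2 \<Rightarrow> L2 \<Rightarrow> L2" is "\<lambda>f g w. f w + g w"
  by (auto simp: L2_rel_def square_integrable_add)

lift_definition uminus_L2 :: "L2 \<Rightarrow> L2" is "\<lambda>f w. - f w"
  by (auto simp: L2_rel_def square_integrable_uminus)

lift_definition scaleC_L2 :: "complex \<Rightarrow> L2 \<Rightarrow> L2" is "\<lambda>c f w. c * f w"
  by (auto simp: L2_rel_def square_integrable_scale)

lift_definition cinner_L2 :: "L2 \<Rightarrow> L2 \<Rightarrow> complex" is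
  "\<lambda>f g. \<integral>w. f w * cnj (g w) \<partial>circle_measure"
proof -
  fix f f' g g' assume *: "L2_rel f f'" "L2_rel g g'"
  then have [measurable]: "f \<in> borel_measurable circle_measure"
      "f' \<in> borel_measurable circle_measure" "g \<in> borel_measurable circle_measure"
      "g' \<in> borel_measurable circle_measure"
    by (auto simp: L2_rel_def square_integrable_def)
  show "(\<integral>w. f w * cnj (g w) \<partial>circle_measure) = (\<integral>w. f' w * cnj (g' w) \<partial>circle_measure)"
  proof (rule integral_cong_AE)
    show "AE w in circle_measure. f w * cnj (g w) = f' w * cnj (g' w)"
      using * by (auto simp: L2_rel_def)
  qed measurable
qed

definition minus_L2 :: "L2 \<Rightarrow> L2 \<Rightarrow> L2" where "minus_L2 f g = f + - g"
definition scaleR_L2 :: "real \<Rightarrow> L2 \<Rightarrow> L2" where "scaleR_L2 r f = complex_of_real r *\<^sub>C f"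
definition inner_L2 :: "L2 \<Rightarrow> L2 \<Rightarrow> real" where "inner_L2 f g = Re (cinner f g)"
definition norm_L2 :: "L2 \<Rightarrow> real" where "norm_L2 f = sqrt (inner f f)"
definition sgn_L2 :: "L2 \<Rightarrow> L2" where "sgn_L2 f = inverse (norm f) *\<^sub>R f"
definition dist_L2 :: "L2 \<Rightarrow> L2 \<Rightarrow> real" where "dist_L2 f g = norm (f - g)"
definition uniformity_L2 :: "(L2 \<times> L2) filter" where
  "uniformity_L2 = (INF e\<in>{0<..}. principal {(x, y). dist x y < e})"
definition open_L2 :: "L2 set \<Rightarrow> bool" where
  "open_L2 U \<longleftrightarrow> (\<forall>x\<in>U. \<forall>\<^sub>F (x', y) in uniformity. x' = x \<longrightarrow> y \<in> U)"

instance
proof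
  fix a b :: complex and r s :: real and f g h :: L2 and U :: "L2 set"
  have sadd: "x *\<^sub>C (u + v) = x *\<^sub>C u + x *\<^sub>C v" for x and u v :: L2
    by transfer (auto simp: L2_rel_def square_integrable_add square_integrable_scale distrib_left)
  have addl: "(x + y) *\<^sub>C u = x *\<^sub>C u + y *\<^sub>C u" for x y and u :: L2
    by transfer (auto simp: L2_rel_def square_integrable_add square_integrable_scale distrib_right)
  have sc: "x *\<^sub>C (y *\<^sub>C u) = (x * y) *\<^sub>C u" for x y and u :: L2
    by transfer (auto simp: L2_rel_def square_integrable_scale mult.assoc)
  have one: "1 *\<^sub>C u = u" for u :: L2
    by transfer (auto simp: L2_rel_def square_integrable_scale)
  have cadd: "cinner (u + v) w = cinner u w + cinner v w" for u v w :: L2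
    by transfer (auto simp: L2_rel_def distrib_right integrable_mult_cnj)
  have cscale: "cinner (x *\<^sub>C u) v = x * cinner u v" for x and u v :: L2
    by transfer (simp add: mult.assoc)
  have ccomm: "cinner u v = cnj (cinner v u)" for u v :: L2
  proof (transfer, goal_cases)
    case (1 u v)
    show ?case
      by (subst Bochner_Integration.integral_cnj[symmetric]) (simp add: mult.commute)
  qed
  have cself: "inner u u \<ge> 0 \<and> (inner u u = 0 \<longleftrightarrow> u = 0)" for u :: L2
    unfolding inner_L2_def
  proof (transfer, goal_cases)
    case (1 f)
    then have int: "integrable circle_measure (\<lambda>w. (cmod (f w))\<^sup>2)" and sq: "square_integrable f"
      by (auto simp: L2_rel_def square_integrable_def)
    have eq: "(\<integral>w. f w * cnj (f w) \<partial>circle_measure)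
        = complex_of_real (\<integral>w. (cmod (f w))\<^sup>2 \<partial>circle_measure)"
      by (simp only: complex_norm_square[symmetric] integral_complex_of_real)
    show ?case
      using integral_nonneg_eq_0_iff_AE[OF int] sq
      by (auto simp: eq L2_rel_def square_integrable_zero intro!: integral_nonneg_AE)
  qed
  show "f + g + h = f + (g + h)"
    by transfer (auto simp: L2_rel_def square_integrable_add add.assoc)
  show "f + g = g + f"
    by transfer (auto simp: L2_rel_def square_integrable_add add.commute)
  show "0 + f = f"
    by transfer (auto simp: L2_rel_def)
  show "- f + f = 0"
    by transfer (auto simp: L2_rel_def square_integrable_add square_integrable_uminus
        square_integrable_zero)
  show "f - g = f + - g"
    by (rule minus_L2_def)
  show "r *\<^sub>R (f + g) = r *\<^sub>R f + r *\<^sub>R g"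
    by (simp add: scaleR_L2_def sadd)
  show "(r + s) *\<^sub>R f = r *\<^sub>R f + s *\<^sub>R f"
    by (simp add: scaleR_L2_def addl)
  show "r *\<^sub>R s *\<^sub>R f = (r * s) *\<^sub>R f"
    by (simp add: scaleR_L2_def sc)
  show "1 *\<^sub>R f = f"
    by (simp add: scaleR_L2_def one)
  show "sgn f = inverse (norm f) *\<^sub>R f"
    by (rule sgn_L2_def)
  show "dist f g = norm (f - g)"
    by (rule dist_L2_def)
  show "uniformity = (INF e\<in>{0<..}. principal {(x, y). dist x (y::L2) < e})"
    by (rule uniformity_L2_def)
  show "open U \<longleftrightarrow> (\<forall>x\<in>U. \<forall>\<^sub>F (x', y) in uniformity. x' = x \<longrightarrow> y \<in> U)"
    by (rule open_L2_def)
  show "inner f g = inner g f"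
    unfolding inner_L2_def by (subst ccomm) simp
  show "inner (f + g) h = inner f h + inner g h"
    by (simp add: inner_L2_def cadd)
  show "inner (r *\<^sub>R f) g = r * inner f g"
    by (simp add: inner_L2_def scaleR_L2_def cscale)
  show "0 \<le> inner f f" "inner f f = 0 \<longleftrightarrow> f = 0"
    using cself by auto
  show "norm f = sqrt (inner f f)"
    by (rule norm_L2_def)
  show "complex_of_real r *\<^sub>C f = r *\<^sub>R f"
    by (simp add: scaleR_L2_def)
  show "a *\<^sub>C (f + g) = a *\<^sub>C f + a *\<^sub>C g" by (rule sadd)
  show "(a + b) *\<^sub>C f = a *\<^sub>C f + b *\<^sub>C f" by (rule addl)
  show "a *\<^sub>C (b *\<^sub>C f) = (a * b) *\<^sub>C f" by (rule sc)
  show "cinner (f + g) h = cinner f h + cinner g h" by (rule cadd)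
  show "cinner (a *\<^sub>C f) g = a * cinner f g" by (rule cscale)
  show "cinner f g = cnj (cinner g f)" by (rule ccomm)
  show "Re (cinner f g) = inner f g" by (simp add: inner_L2_def)
qed

end

lift_definition cnj_L2 :: "L2 \<Rightarrow> L2" is "\<lambda>f w. cnj (f w)"
  by (auto simp: L2_rel_def square_integrable_cnj)

lemma square_integrable_power_int: "square_integrable (\<lambda>w. w powi n)"
proof -
  have [measurable]: "(\<lambda>w::complex. w powi n) \<in> borel_measurable borel"
    unfolding power_int_def by measurable
  have "integrable circle_measure (\<lambda>w. (cmod (w powi n))\<^sup>2)"
  proof (rule circle.integrable_const_bound[where B = 1])
    show "AE w in circle_measure. norm ((cmod (w powi n))\<^sup>2) \<le> 1"
      using AE_circle_measure_norm by (auto simp: norm_power_int)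
  qed measurable
  then show ?thesis by (simp add: square_integrable_def)
qed

text \<open>The function \<open>w \<mapsto> w\<^sup>n\<close> on the circle.\<close>

lift_definition zpow :: "int \<Rightarrow> L2" is "\<lambda>n w. w powi n"
  by (simp add: L2_rel_def square_integrable_power_int)

definition fourier_coeff :: "L2 \<Rightarrow> int \<Rightarrow> complex" where
  "fourier_coeff g n = cinner g (zpow n)"

lift_definition ess_bounded :: "L2 \<Rightarrow> bool" is
  "\<lambda>f. \<exists>C. AE w in circle_measure. cmod (f w) \<le> C"
proof -
  have "\<exists>C. AE w in circle_measure. cmod (g w) \<le> C"
    if "L2_rel f g" "AE w in circle_measure. cmod (f w) \<le> C" for f g C
    using that by (intro exI[of _ C]) (auto simp: L2_rel_def)
  moreover have "L2_rel g f" if "L2_rel f g" for f g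
    using that by (auto simp: L2_rel_def)
  ultimately show "(\<exists>C. AE w in circle_measure. cmod (f w) \<le> C) \<longleftrightarrow>
      (\<exists>C. AE w in circle_measure. cmod (g w) \<le> C)" if "L2_rel f g" for f g
    using that by blast
qed

text \<open>The circle has finite measure, so \<open>L\<^sup>\<infinity>\<close> is a subset of \<open>L\<^sup>2\<close>.\<close>

definition Linf :: "L2 set" where
  "Linf = {g. ess_bounded g}"

text \<open>Pointwise product of classes; meaningful if the product is again square-integrable, in
  particular if the first factor is in \<open>Linf\<close>.\<close>

definition mult_L2 :: "L2 \<Rightarrow> L2 \<Rightarrow> L2" where
  "mult_L2 f g = abs_L2 (\<lambda>w. rep_L2 f w * rep_L2 g w)"

section \<open>The Hardy space and Toeplitz operators\<close>

definition H2 :: "L2 set" where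
  "H2 = {g. \<forall>n<0. fourier_coeff g n = 0}"

definition Hinf :: "L2 set" where
  "Hinf = Linf \<inter> H2"

lemma cinner_zero_left_L2: "cinner (0::L2) g = 0"
  by transfer simp

lemma H2_zero: "0 \<in> H2"
  by (simp add: H2_def fourier_coeff_def cinner_zero_left_L2)

lemma H2_add: "f \<in> H2 \<Longrightarrow> g \<in> H2 \<Longrightarrow> f + g \<in> H2"
  by (simp add: H2_def fourier_coeff_def cinner_add_left)

lemma H2_scaleC: "f \<in> H2 \<Longrightarrow> c *\<^sub>C f \<in> H2"
  by (simp add: H2_def fourier_coeff_def cinner_scaleC_left)

lemma H2_scaleR: "f \<in> H2 \<Longrightarrow> r *\<^sub>R f \<in> H2"
  by (metis H2_scaleC scaleC_of_real)

lemma H2_uminus: "f \<in> H2 \<Longrightarrow> - f \<in> H2"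
  using H2_scaleR[of f "-1"] by simp

lemma H2_diff: "f \<in> H2 \<Longrightarrow> g \<in> H2 \<Longrightarrow> f - g \<in> H2"
  using H2_add[of f "- g"] H2_uminus[of g] by simp

typedef hardy = H2
  using H2_zero by blast

setup_lifting type_definition_hardy

instantiation hardy :: complex_inner
begin

lift_definition zero_hardy :: hardy is 0 by (rule H2_zero)
lift_definition plus_hardy :: "hardy \<Rightarrow> hardy \<Rightarrow> hardy" is "(+)" by (rule H2_add)
lift_definition minus_hardy :: "hardy \<Rightarrow> hardy \<Rightarrow> hardy" is "(-)" by (rule H2_diff)
lift_definition uminus_hardy :: "hardy \<Rightarrow> hardy" is uminus by (rule H2_uminus)
lift_definition scaleR_hardy :: "real \<Rightarrow> hardy \<Rightarrow> hardy" is scaleR by (rule H2_scaleR)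
lift_definition scaleC_hardy :: "complex \<Rightarrow> hardy \<Rightarrow> hardy" is scaleC by (rule H2_scaleC)
lift_definition inner_hardy :: "hardy \<Rightarrow> hardy \<Rightarrow> real" is inner .
lift_definition cinner_hardy :: "hardy \<Rightarrow> hardy \<Rightarrow> complex" is cinner .
lift_definition norm_hardy :: "hardy \<Rightarrow> real" is norm .
lift_definition dist_hardy :: "hardy \<Rightarrow> hardy \<Rightarrow> real" is dist .
definition sgn_hardy :: "hardy \<Rightarrow> hardy" where "sgn_hardy f = inverse (norm f) *\<^sub>R f"
definition uniformity_hardy :: "(hardy \<times> hardy) filter" where
  "uniformity_hardy = (INF e\<in>{0<..}. principal {(x, y). dist x y < e})"
definition open_hardy :: "hardy set \<Rightarrow> bool" where
  "open_hardy U \<longleftrightarrow> (\<forall>x\<in>U. \<forall>\<^sub>F (x', y) in uniformity. x' = x \<longrightarrow> y \<in> U)"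

instance
proof
  fix a b :: complex and r s :: real and f g h :: hardy and U :: "hardy set"
  show "f + g + h = f + (g + h)" by transfer (rule add.assoc)
  show "f + g = g + f" by transfer (rule add.commute)
  show "0 + f = f" by transfer simp
  show "- f + f = 0" by transfer simp
  show "f - g = f + - g" by transfer simp
  show "r *\<^sub>R (f + g) = r *\<^sub>R f + r *\<^sub>R g" by transfer (rule scaleR_add_right)
  show "(r + s) *\<^sub>R f = r *\<^sub>R f + s *\<^sub>R f" by transfer (rule scaleR_add_left)
  show "r *\<^sub>R s *\<^sub>R f = (r * s) *\<^sub>R f" by transfer simp
  show "1 *\<^sub>R f = f" by transfer simp
  show "sgn f = inverse (norm f) *\<^sub>R f" by (rule sgn_hardy_def)
  show "dist f g = norm (f - g)" by transfer (rule dist_norm)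
  show "uniformity = (INF e\<in>{0<..}. principal {(x, y). dist x (y::hardy) < e})"
    by (rule uniformity_hardy_def)
  show "open U \<longleftrightarrow> (\<forall>x\<in>U. \<forall>\<^sub>F (x', y) in uniformity. x' = x \<longrightarrow> y \<in> U)"
    by (rule open_hardy_def)
  show "inner f g = inner g f" by transfer (rule inner_commute)
  show "inner (f + g) h = inner f h + inner g h" by transfer (rule inner_add_left)
  show "inner (r *\<^sub>R f) g = r * inner f g" by transfer simp
  show "0 \<le> inner f f" by transfer simp
  show "inner f f = 0 \<longleftrightarrow> f = 0" by transfer simp
  show "norm f = sqrt (inner f f)" by transfer (rule norm_eq_sqrt_inner)
  show "complex_of_real r *\<^sub>C f = r *\<^sub>R f" by transfer (rule scaleC_of_real)
  show "a *\<^sub>C (f + g) = a *\<^sub>C f + a *\<^sub>C g" by transfer (rule scaleC_add_right)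
  show "(a + b) *\<^sub>C f = a *\<^sub>C f + b *\<^sub>C f" by transfer (rule scaleC_add_left)
  show "a *\<^sub>C (b *\<^sub>C f) = (a * b) *\<^sub>C f" by transfer (rule scaleC_scaleC)
  show "cinner (f + g) h = cinner f h + cinner g h" by transfer (rule cinner_add_left)
  show "cinner (a *\<^sub>C f) g = a * cinner f g" by transfer (rule cinner_scaleC_left)
  show "cinner f g = cnj (cinner g f)" by transfer (rule cinner_commute)
  show "Re (cinner f g) = inner f g" by transfer (rule Re_cinner)
qed

end

text \<open>The orthogonal projection of \<open>L\<^sup>2\<close> onto \<open>H\<^sup>2\<close>.\<close>

definition hardy_proj :: "L2 \<Rightarrow> hardy" where
  "hardy_proj g = (THE h. \<forall>k. cinner (g - Rep_hardy h) (Rep_hardy k) = 0)"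

definition toeplitz :: "L2 \<Rightarrow> hardy \<Rightarrow> hardy" where
  "toeplitz \<phi> h = hardy_proj (mult_L2 \<phi> (Rep_hardy h))"

definition shift :: "hardy \<Rightarrow> hardy" where
  "shift = toeplitz (zpow 1)"

text \<open>\<open>taylor_coeff f n\<close> is the coefficient \<open>a\<^sub>n\<close> of \<open>f(z) = \<Sum> a\<^sub>n z\<^sup>n\<close>, and
  \<open>hardy_series a\<close> is \<open>\<Sum> a\<^sub>n z\<^sup>n\<close>, a norm-convergent series if \<open>a\<close> is square-summable.\<close>

definition taylor_coeff :: "hardy \<Rightarrow> nat \<Rightarrow> complex" where
  "taylor_coeff f n = fourier_coeff (Rep_hardy f) (int n)"

definition hardy_series :: "(nat \<Rightarrow> complex) \<Rightarrow> hardy" where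
  "hardy_series a = (\<Sum>n. a n *\<^sub>C Abs_hardy (zpow (int n)))"

text \<open>\<open>f \<mapsto> (f\<^sub>2, f\<^sub>1)\<close>, where \<open>f(z) = f\<^sub>2(z\<^sup>2) + z f\<^sub>1(z\<^sup>2)\<close>.\<close>

definition even_odd :: "hardy \<Rightarrow> hardy \<times> hardy" where
  "even_odd f = (hardy_series (\<lambda>n. taylor_coeff f (2 * n)),
                 hardy_series (\<lambda>n. taylor_coeff f (2 * n + 1)))"

end

theory Submission
  imports Defs
begin

text \<open>Every operator in sight has an adjoint, so equality of operators can be tested on the matrix
  entries \<open>x(i, j) = \<langle>X z\<^sup>i, z\<^sup>j\<rangle>\<close>. In these terms \<open>S X = X\<^sup>* S\<close> says that
  \<open>x(i, j)\<close> is the conjugate of \<open>x(j + 1, i + 1)\<close> and that \<open>x(0, j + 1) = 0\<close>. Applying the first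
  relation twice gives \<open>x(i + 2, j + 2) = x(i, j)\<close>, so the four parity classes of entries are
  Toeplitz matrices: the even--odd one vanishes, the odd--odd one is triangular and conjugate
  to the even--even one, and the odd--even one has coefficients \<open>c\<^sub>n\<close> with
  \<open>c\<^sub>n\<close> conjugate to \<open>c\<close> at \<open>1 - n\<close>, i.e. those of \<open>cnj f + z f\<close>. The symbols can be read off the
  function \<open>X z\<close>, and they are essentially bounded by the argument of Brown and Halmos.\<close>

section \<open>Completeness of \<open>L\<^sup>2\<close>\<close>

text \<open>The operators are given by choices: \<open>hardy_series\<close> is a limit,
  \<open>hardy_proj\<close> a definite description, \<open>cadjoint\<close> an arbitrary choice.
  None of them says anything before existence is shown, and existence rests each time on the fact
  that a square-summable sequence is the coefficient sequence of a vector. Hence completeness and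
  the uniqueness of Fourier coefficients come before the operator equation. The single vector X z
  suffices for both symbols: a triangular Toeplitz matrix is determined by the entries x(1, j), and
  the reflection n -> 1 - n fixes no integer, so the c_n with n >= 1 are free, determine the others,
  and are the coefficients of z f. Boundedness is delicate because a symbol is at first only an L2
  class g, and multiplication by g need not stay inside L2. Pairings <g p, q> are therefore first
  formed with p and q in \<open>Linf\<close>, and g is moved between the two slots before a limit is
  taken.\<close>

lemma square_integrable_rep_L2: "square_integrable (rep_L2 f)"
  using Quotient3_rel_rep[OF Quotient3_L2, of f f] by (simp add: L2_rel_def)

lemma abs_rep_L2: "abs_L2 (rep_L2 f) = f"
  by (rule Quotient3_abs_rep[OF Quotient3_L2])

lemma AE_rep_abs_L2:
  assumes "square_integrable F"
  shows "AE w in circle_measure. rep_L2 (abs_L2 F) w = F w"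
  using rep_abs_rsp_left[OF Quotient3_L2, of F F] assms by (simp add: L2_rel_def)

lemma abs_L2_eqI:
  assumes "square_integrable F" "square_integrable G" "AE w in circle_measure. F w = G w"
  shows "abs_L2 F = abs_L2 G"
  using Quotient3_rel_abs[OF Quotient3_L2, of F G] assms by (simp add: L2_rel_def)

lemma rep_L2_measurable [measurable]: "rep_L2 f \<in> borel_measurable borel"
  using square_integrable_measurable[OF square_integrable_rep_L2] by simp

lemma cinner_abs_L2:
  assumes "square_integrable F" "square_integrable G"
  shows "cinner (abs_L2 F) (abs_L2 G) = (\<integral>w. F w * cnj (G w) \<partial>circle_measure)"
  using assms by (intro cinner_L2.abs_eq) (auto simp: L2_rel_def)

lemma cinner_L2_rep: "cinner f g = (\<integral>w. rep_L2 f w * cnj (rep_L2 g w) \<partial>circle_measure)"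
  using cinner_abs_L2[OF square_integrable_rep_L2 square_integrable_rep_L2, of f g]
  by (simp add: abs_rep_L2)

lemma norm_L2_power2: "(norm (f::L2))\<^sup>2 = (\<integral>w. (cmod (rep_L2 f w))\<^sup>2 \<partial>circle_measure)"
proof -
  have "(norm f)\<^sup>2 = Re (cinner f f)"
    by (simp add: power2_norm_eq_inner Re_cinner)
  then show ?thesis
    by (simp only: cinner_L2_rep complex_norm_square[symmetric] integral_complex_of_real Re_complex_of_real)
qed

lemma abs_L2_diff:
  assumes "square_integrable F" "square_integrable G"
  shows "abs_L2 F - abs_L2 G = abs_L2 (\<lambda>w. F w - G w)"
  using assms
  by (simp add: minus_L2_def uminus_L2.abs_eq plus_L2.abs_eq L2_rel_def square_integrable_uminus)

lemma square_integrable_diff: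
  assumes "square_integrable f" "square_integrable g"
  shows "square_integrable (\<lambda>w. f w - g w)"
  using square_integrable_add[OF assms(1) square_integrable_uminus[OF assms(2)]] by simp

lemma norm_abs_L2:
  assumes "square_integrable F"
  shows "ennreal ((norm (abs_L2 F))\<^sup>2) = (\<integral>\<^sup>+w. ennreal ((cmod (F w))\<^sup>2) \<partial>circle_measure)"
proof -
  have "(norm (abs_L2 F))\<^sup>2 = Re (cinner (abs_L2 F) (abs_L2 F))"
    by (simp add: power2_norm_eq_inner Re_cinner)
  also have "\<dots> = (\<integral>w. (cmod (F w))\<^sup>2 \<partial>circle_measure)"
    using assms
    by (simp only: cinner_abs_L2 complex_norm_square[symmetric] integral_complex_of_real Re_complex_of_real)
  finally show ?thesis
    using assms by (simp add: nn_integral_eq_integral square_integrable_def)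
qed

lemma square_integrableI_nn_integral:
  assumes "F \<in> borel_measurable borel"
    and "(\<integral>\<^sup>+w. ennreal ((cmod (F w))\<^sup>2) \<partial>circle_measure) < \<infinity>"
  shows "square_integrable F"
  using assms unfolding square_integrable_def
  by (auto intro!: integrableI_bounded measurable_compose[OF assms(1)])

text \<open>A rapidly convergent subsequence converges almost everywhere, and Fatou's lemma turns
  its pointwise limit into a norm limit of the whole sequence.\<close>

lemma L2_complete:
  fixes X :: "nat \<Rightarrow> L2"
  assumes "Cauchy X"
  shows "convergent X"
proof -
  define F where "F n = rep_L2 (X n)" for n
  have sF: "square_integrable (F n)" for n
    by (simp add: F_def square_integrable_rep_L2)
  have [measurable]: "F n \<in> borel_measurable borel" for n
    by (simp add: F_def)
  have nF: "(\<integral>\<^sup>+w. ennreal ((cmod (F m w - F n w))\<^sup>2) \<partial>circle_measure) = ennreal ((norm (X m - X n))\<^sup>2)" for m n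
    using norm_abs_L2[OF square_integrable_diff[OF sF sF], of m n] abs_L2_diff[OF sF sF, of m n]
    by (simp add: F_def abs_rep_L2)
  have "\<exists>N. \<forall>m\<ge>N. \<forall>n\<ge>N. norm (X m - X n) < (1/2) ^ k" for k :: nat
    using assms by (auto intro!: CauchyD)
  then obtain N where N: "\<And>k m n. m \<ge> N k \<Longrightarrow> n \<ge> N k \<Longrightarrow> norm (X m - X n) < (1/2) ^ k"
    by metis
  define r where "r k = k + Max (N ` {..k})" for k
  have rN: "r k \<ge> N j" if "j \<le> k" for j k
    using that unfolding r_def by (intro trans_le_add2 Max_ge) auto
  have r_step: "norm (X (r (Suc k)) - X (r k)) < (1/2) ^ k" for k
    by (intro N rN) auto
  define d where "d k w = cmod (F (r (Suc k)) w - F (r k) w)" for k w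
  have [measurable]: "d k \<in> borel_measurable borel" for k
    unfolding d_def by measurable
  \<comment> \<open>The weighted sum of squares replaces a sum of norms: the integrals are summable
    since 3/2 * 1/4 = 3/8 < 1, while finiteness at w forces \<open>d k w\<close> below sqrt (2/3) ^
    k eventually, which is summable again. Any weight strictly between 1 and 4 would do.\<close>
  have sum_fin: "(\<Sum>k. \<integral>\<^sup>+w. ennreal ((3/2) ^ k * (d k w)\<^sup>2) \<partial>circle_measure) \<noteq> \<infinity>"
  proof -
    have "(\<integral>\<^sup>+w. ennreal ((3/2) ^ k * (d k w)\<^sup>2) \<partial>circle_measure) \<le> ennreal ((3/8) ^ k)" for k
    proof -
      have "(\<integral>\<^sup>+w. ennreal ((3/2) ^ k * (d k w)\<^sup>2) \<partial>circle_measure)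
          = ennreal ((3/2) ^ k) * ennreal ((norm (X (r (Suc k)) - X (r k)))\<^sup>2)"
        unfolding nF[symmetric] d_def by (subst nn_integral_cmult[symmetric]) (auto simp: ennreal_mult)
      also have "\<dots> \<le> ennreal ((3/2) ^ k) * ennreal (((1/2) ^ k)\<^sup>2)"
        using r_step[of k] by (intro mult_left_mono ennreal_leI power_mono) auto
      also have "\<dots> = ennreal ((3/8) ^ k)"
        by (simp add: power2_eq_square flip: ennreal_mult power_mult_distrib)
      finally show ?thesis .
    qed
    then have "(\<Sum>k. \<integral>\<^sup>+w. ennreal ((3/2) ^ k * (d k w)\<^sup>2) \<partial>circle_measure) \<le> (\<Sum>k. ennreal ((3/8) ^ k))"
      by (intro suminf_le) auto
    also have "\<dots> = ennreal (\<Sum>k. (3/8) ^ k)"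
      by (intro suminf_ennreal2) (auto intro: summable_geometric)
    finally show ?thesis
      by (auto simp: top_unique)
  qed
  have ae: "AE w in circle_measure. (\<Sum>k. ennreal ((3/2) ^ k * (d k w)\<^sup>2)) \<noteq> \<infinity>"
    using sum_fin by (intro nn_integral_PInf_AE) (auto simp: nn_integral_suminf)
  have conv: "convergent (\<lambda>k. F (r k) w)" if "(\<Sum>k. ennreal ((3/2) ^ k * (d k w)\<^sup>2)) \<noteq> \<infinity>" for w
  proof -
    have "summable (\<lambda>k. (3/2) ^ k * (d k w)\<^sup>2)"
      using that by (intro summable_suminf_not_top) auto
    then have "(\<lambda>k. (3/2) ^ k * (d k w)\<^sup>2) \<longlonglongrightarrow> 0"
      by (rule summable_LIMSEQ_zero)
    then have "\<forall>\<^sub>F k in sequentially. (3/2) ^ k * (d k w)\<^sup>2 < 1"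
      by (rule order_tendstoD) simp
    then have ev: "\<forall>\<^sub>F k in sequentially. d k w \<le> sqrt (2/3) ^ k"
    proof eventually_elim
      case (elim k)
      have "(d k w)\<^sup>2 \<le> (2/3) ^ k"
        using elim by (simp add: field_simps power_divide)
      then have "sqrt ((d k w)\<^sup>2) \<le> sqrt ((2/3) ^ k)"
        by (rule real_sqrt_le_mono)
      then show ?case
        by (simp add: d_def real_sqrt_power)
    qed
    have "summable (\<lambda>k. sqrt (2/3) ^ k :: real)"
      by (intro summable_geometric) (simp add: real_sqrt_lt_1_iff)
    then have "summable (\<lambda>k. F (r (Suc k)) w - F (r k) w)"
      by (rule summable_comparison_test_ev[rotated]) (use ev in \<open>simp add: d_def\<close>)
    then have "convergent (\<lambda>n. \<Sum>k<n. F (r (Suc k)) w - F (r k) w)"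
      by (simp add: summable_iff_convergent)
    then have "convergent (\<lambda>n. F (r n) w - F (r 0) w)"
      by (simp add: sum_lessThan_telescope[of "\<lambda>k. F (r k) w"])
    then show ?thesis
      by (simp add: convergent_diff_const_right_iff)
  qed
  define G where "G w = lim (\<lambda>k. F (r k) w)" for w
  have [measurable]: "G \<in> borel_measurable borel"
    unfolding G_def by measurable
  have lim: "AE w in circle_measure. (\<lambda>k. F (r k) w) \<longlonglongrightarrow> G w"
    using ae by eventually_elim (use conv in \<open>simp add: G_def convergent_LIMSEQ_iff\<close>)
  \<comment> \<open>Fatou in k with n fixed: as soon as k >= j, both \<open>r k\<close> and n lie
    beyond \<open>N j\<close>.\<close>
  have bound: "(\<integral>\<^sup>+w. ennreal ((cmod (G w - F n w))\<^sup>2) \<partial>circle_measure) \<le> ennreal (((1/2) ^ j)\<^sup>2)"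
    if n: "n \<ge> N j" for n j
  proof -
    have "(\<integral>\<^sup>+w. ennreal ((cmod (G w - F n w))\<^sup>2) \<partial>circle_measure)
        = (\<integral>\<^sup>+w. liminf (\<lambda>k. ennreal ((cmod (F (r k) w - F n w))\<^sup>2)) \<partial>circle_measure)"
    proof (rule nn_integral_cong_AE, use lim in eventually_elim)
      case (elim w)
      have "(\<lambda>k. ennreal ((cmod (F (r k) w - F n w))\<^sup>2)) \<longlonglongrightarrow> ennreal ((cmod (G w - F n w))\<^sup>2)"
        by (intro tendsto_intros elim)
      from lim_imp_Liminf[OF sequentially_bot this] show ?case by simp
    qed
    also have "\<dots> \<le> liminf (\<lambda>k. \<integral>\<^sup>+w. ennreal ((cmod (F (r k) w - F n w))\<^sup>2) \<partial>circle_measure)"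
      by (intro nn_integral_liminf) measurable
    also have "\<dots> \<le> limsup (\<lambda>k. \<integral>\<^sup>+w. ennreal ((cmod (F (r k) w - F n w))\<^sup>2) \<partial>circle_measure)"
      by (intro Liminf_le_Limsup) auto
    also have "\<dots> \<le> ennreal (((1/2) ^ j)\<^sup>2)"
      unfolding nF
      by (intro Limsup_bounded eventually_sequentiallyI[of j] ennreal_leI power_mono
          less_imp_le[OF N[of j]] rN n) auto
    finally show ?thesis .
  qed
  have "square_integrable (\<lambda>w. G w - F (N 0) w)"
    using bound[of 0 "N 0"] by (intro square_integrableI_nn_integral) (auto simp: le_less_trans)
  then have sG: "square_integrable G"
    using square_integrable_add[OF _ sF, of "\<lambda>w. G w - F (N 0) w" "N 0"] by simp
  have "X \<longlonglongrightarrow> abs_L2 G"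
  proof (rule LIMSEQ_I)
    fix e :: real assume "e > 0"
    then obtain j where j: "(1/2) ^ j < e"
      using real_arch_pow_inv[of e "1/2"] by auto
    have "norm (X n - abs_L2 G) < e" if n: "n \<ge> N j" for n
    proof -
      have "ennreal ((norm (abs_L2 G - X n))\<^sup>2) \<le> ennreal (((1/2) ^ j)\<^sup>2)"
        using bound[OF n] norm_abs_L2[OF square_integrable_diff[OF sG sF], of n]
          abs_L2_diff[OF sG sF, of n] by (simp add: F_def abs_rep_L2)
      then have "norm (abs_L2 G - X n) \<le> (1/2) ^ j"
        by (simp add: power2_le_iff_abs_le)
      then show ?thesis
        using j by (simp add: norm_minus_commute)
    qed
    then show "\<exists>no. \<forall>n\<ge>no. norm (X n - abs_L2 G) < e" by blast
  qed
  then show ?thesis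
    by (rule convergentI)
qed

section \<open>Uniqueness of Fourier coefficients\<close>

text \<open>The bound is asked for on the circle only, because the factors of interest, powers and
  polynomials, are unbounded on the plane; the measure does not see the difference.\<close>

lemma integrable_mult_bounded:
  fixes \<gamma> G :: "complex \<Rightarrow> complex"
  assumes \<gamma>: "integrable circle_measure \<gamma>" and [measurable]: "G \<in> borel_measurable borel"
    and G: "\<And>w. cmod w = 1 \<Longrightarrow> cmod (G w) \<le> K"
  shows "integrable circle_measure (\<lambda>w. G w * \<gamma> w)"
proof (rule Bochner_Integration.integrable_bound)
  have [measurable]: "\<gamma> \<in> borel_measurable circle_measure"
    using \<gamma> by auto
  show "(\<lambda>w. G w * \<gamma> w) \<in> borel_measurable circle_measure"
    by measurable
  show "integrable circle_measure (\<lambda>w. complex_of_real K * \<gamma> w)"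
    using \<gamma> by auto
  show "AE w in circle_measure. norm (G w * \<gamma> w) \<le> norm (complex_of_real K * \<gamma> w)"
    using AE_circle_measure_norm
  proof eventually_elim
    case (elim w)
    then show ?case
      using G[of w] by (auto simp: norm_mult intro!: mult_right_mono)
  qed
qed

lemma measurable_power_int_complex [measurable]: "(\<lambda>w::complex. w powi n) \<in> borel_measurable borel"
  unfolding power_int_def by measurable

lemma integrable_power_int_mult:
  "integrable circle_measure \<gamma> \<Longrightarrow> integrable circle_measure (\<lambda>w. w powi n * \<gamma> w)"
  by (rule integrable_mult_bounded[where K = 1]) (auto simp: norm_power_int)

text \<open>The class of \<open>\<gamma>\<close> with vanishing Fourier coefficients is invariant under multiplication by
  the coordinate functions, hence by polynomials; this avoids expanding polynomials into
  trigonometric sums.\<close>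

lemma fourier_vanish_mult_real_polynomial_function:
  assumes "real_polynomial_function F"
    and "integrable circle_measure \<gamma>" "\<And>n. (\<integral>w. w powi n * \<gamma> w \<partial>circle_measure) = 0"
  shows "integrable circle_measure (\<lambda>w. complex_of_real (F w) * \<gamma> w)"
    and "(\<integral>w. w powi n * (complex_of_real (F w) * \<gamma> w) \<partial>circle_measure) = 0"
proof -
  have "integrable circle_measure (\<lambda>w. complex_of_real (F w) * \<gamma> w) \<and>
      (\<forall>n. (\<integral>w. w powi n * (complex_of_real (F w) * \<gamma> w) \<partial>circle_measure) = 0)"
    using assms
  proof (induction F arbitrary: \<gamma> rule: real_polynomial_function.induct)
    case (linear F)
    \<comment> \<open>On the circle Re w = (w + 1/w) / 2 and Im w = (w - 1/w) / (2 i), so a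
      real-linear F becomes a combination of the powers 1 and -1.\<close>
    define \<alpha> \<beta> where "\<alpha> = complex_of_real (F 1) / 2 - \<i> * complex_of_real (F \<i>) / 2"
      and "\<beta> = complex_of_real (F 1) / 2 + \<i> * complex_of_real (F \<i>) / 2"
    have F: "complex_of_real (F w) = \<alpha> * w powi 1 + \<beta> * w powi (-1)" if "cmod w = 1" for w
    proof -
      interpret bounded_linear F by fact
      have "w = Re w *\<^sub>R 1 + Im w *\<^sub>R \<i>"
        by (simp add: complex_eq_iff)
      then have Fw: "F w = Re w * F 1 + Im w * F \<i>"
        by (metis add scaleR real_scaleR_def)
      have iw: "w powi (-1) = cnj w"
        using that complex_norm_square[of w] by (auto simp: power_int_minus intro!: inverse_unique)
      show ?thesis
        unfolding iw Fw by (simp add: \<alpha>_def \<beta>_def complex_eq_iff field_simps)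
    qed
    have eq: "AE w in circle_measure. w powi n * (complex_of_real (F w) * \<gamma> w)
        = \<alpha> * (w powi (n + 1) * \<gamma> w) + \<beta> * (w powi (n - 1) * \<gamma> w)" for n
      using AE_circle_measure_norm
    proof eventually_elim
      case (elim w)
      then have "w \<noteq> 0" by auto
      then show ?case
        unfolding F[OF elim]
        by (simp add: power_int_add power_int_diff power_int_minus field_simps)
    qed
    have [measurable]: "F \<in> borel_measurable borel"
      using linear.hyps by (intro borel_measurable_continuous_onI linear_continuous_on)
    have [measurable]: "\<gamma> \<in> borel_measurable circle_measure"
      using linear.prems by auto
    have int: "integrable circle_measure (\<lambda>w. w powi n * \<gamma> w)" for n
      using linear.prems by (rule_tac integrable_power_int_mult)
    have "integrable circle_measure (\<lambda>w. w powi 0 * (complex_of_real (F w) * \<gamma> w))"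
      by (subst integrable_cong_AE[OF _ _ eq])
        (measurable, intro Bochner_Integration.integrable_add integrable_mult_right int)
    moreover have "(\<integral>w. w powi n * (complex_of_real (F w) * \<gamma> w) \<partial>circle_measure) = 0" for n
      by (subst integral_cong_AE[OF _ _ eq])
        (use int linear.prems in \<open>auto simp: Bochner_Integration.integral_add\<close>)
    ultimately show ?case by simp
  next
    case (const c)
    have "w powi n * (complex_of_real c * \<gamma> w) = complex_of_real c * (w powi n * \<gamma> w)" for w n
      by simp
    then show ?case
      using const by (simp only: integral_mult_right_zero) auto
  next
    case (add F G)
    have "w powi n * (complex_of_real (F w + G w) * \<gamma> w)
        = w powi n * (complex_of_real (F w) * \<gamma> w) + w powi n * (complex_of_real (G w) * \<gamma> w)" for w n
      by (simp add: algebra_simps)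
    moreover have "complex_of_real (F w + G w) * \<gamma> w
        = complex_of_real (F w) * \<gamma> w + complex_of_real (G w) * \<gamma> w" for w
      by (simp add: algebra_simps)
    ultimately show ?case
      using add.IH[OF add.prems]
      by (simp only:) (auto simp: integrable_power_int_mult Bochner_Integration.integral_add)
  next
    case (mult F G)
    have "integrable circle_measure (\<lambda>w. complex_of_real (G w) * \<gamma> w) \<and>
      (\<forall>n. (\<integral>w. w powi n * (complex_of_real (G w) * \<gamma> w) \<partial>circle_measure) = 0)"
      by (rule mult.IH(2)[OF mult.prems])
    then show ?case
      using mult.IH(1)[of "\<lambda>w. complex_of_real (G w) * \<gamma> w"] by (simp add: mult.assoc)
  qed
  then show "integrable circle_measure (\<lambda>w. complex_of_real (F w) * \<gamma> w)"
    and "(\<integral>w. w powi n * (complex_of_real (F w) * \<gamma> w) \<partial>circle_measure) = 0"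
    by auto
qed

context
  fixes \<gamma> :: "complex \<Rightarrow> complex"
  assumes int: "integrable circle_measure \<gamma>"
    and zero: "\<And>n. (\<integral>w. w powi n * \<gamma> w \<partial>circle_measure) = 0"
begin

private lemma measurable_\<gamma>: "\<gamma> \<in> borel_measurable borel"
  using int borel_measurable_integrable by fastforce

text \<open>By Stone-Weierstrass, F is uniformly within e of a polynomial on the circle, and
  polynomials integrate to 0 against \<gamma>; so the integral is at most e times the L1 norm of
  \<gamma>.\<close>

lemma fourier_vanish_continuous:
  fixes F :: "complex \<Rightarrow> real"
  assumes F: "continuous_on UNIV F"
  shows "(\<integral>w. complex_of_real (F w) * \<gamma> w \<partial>circle_measure) = 0"
proof -
  note measurable_\<gamma> [measurable]
  have [measurable]: "F \<in> borel_measurable borel"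
    using F by (rule borel_measurable_continuous_onI)
  have cF: "continuous_on (sphere 0 1) F"
    using F continuous_on_subset by blast
  then have "bounded (F ` sphere 0 1)"
    by (intro compact_imp_bounded compact_continuous_image) auto
  then obtain K where "\<forall>w\<in>sphere 0 1. \<bar>F w\<bar> \<le> K"
    by (auto simp: bounded_iff)
  then have K: "\<And>w. cmod w = 1 \<Longrightarrow> \<bar>F w\<bar> \<le> K"
    by simp
  have iF: "integrable circle_measure (\<lambda>w. complex_of_real (F w) * \<gamma> w)"
    by (rule integrable_mult_bounded[OF int, where K = K]) (auto simp: K)
  define N where "N = (\<integral>w. cmod (\<gamma> w) \<partial>circle_measure)"
  have le: "cmod (\<integral>w. complex_of_real (F w) * \<gamma> w \<partial>circle_measure) \<le> e * N" if e: "e > 0" for e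
  proof -
    obtain G where G: "real_polynomial_function G" "\<And>w. w \<in> sphere 0 1 \<Longrightarrow> \<bar>F w - G w\<bar> < e"
      using Stone_Weierstrass_real_polynomial_function[OF compact_sphere cF e] by blast
    note v = fourier_vanish_mult_real_polynomial_function[OF G(1) int zero]
    have "(\<integral>w. complex_of_real (F w) * \<gamma> w \<partial>circle_measure)
        = (\<integral>w. complex_of_real (F w) * \<gamma> w - complex_of_real (G w) * \<gamma> w \<partial>circle_measure)"
      using v(1) v(2)[of 0] iF by (simp add: Bochner_Integration.integral_diff)
    also have "cmod \<dots> \<le> (\<integral>w. cmod (complex_of_real (F w) * \<gamma> w - complex_of_real (G w) * \<gamma> w) \<partial>circle_measure)"
      by (rule integral_norm_bound)
    also have "\<dots> \<le> (\<integral>w. e * cmod (\<gamma> w) \<partial>circle_measure)"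
    proof (rule integral_mono_AE)
      show "integrable circle_measure (\<lambda>w. cmod (complex_of_real (F w) * \<gamma> w - complex_of_real (G w) * \<gamma> w))"
        using iF v by auto
      show "integrable circle_measure (\<lambda>w. e * cmod (\<gamma> w))"
        using int by auto
      show "AE w in circle_measure. cmod (complex_of_real (F w) * \<gamma> w - complex_of_real (G w) * \<gamma> w) \<le> e * cmod (\<gamma> w)"
        using AE_circle_measure_norm
      proof eventually_elim
        case (elim w)
        have "cmod (complex_of_real (F w) * \<gamma> w - complex_of_real (G w) * \<gamma> w) = \<bar>F w - G w\<bar> * cmod (\<gamma> w)"
          by (metis left_diff_distrib norm_mult norm_of_real of_real_diff)
        then show ?case
          using G(2)[of w] elim by (auto intro!: mult_right_mono)
      qed
    qed
    finally show ?thesis by (simp add: N_def)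
  qed
  have "N \<ge> 0" by (simp add: N_def)
  \<comment> \<open>N can be 0, hence the divisor N + 1.\<close>
  then have "e / (N + 1) * N \<le> e" "e / (N + 1) > 0" if "e > 0" for e
    using that by (auto simp: field_simps)
  then have "cmod (\<integral>w. complex_of_real (F w) * \<gamma> w \<partial>circle_measure) \<le> 0 + e" if "e > 0" for e
    using le[of "e / (N + 1)"] that by fastforce
  then have "cmod (\<integral>w. complex_of_real (F w) * \<gamma> w \<partial>circle_measure) \<le> 0"
    by (rule field_le_epsilon)
  then show ?thesis by simp
qed

text \<open>The indicator of a closed set is the pointwise limit of the continuous functions max 0
  (1 - n dist(w, C)), and dominated convergence applies.\<close>

lemma fourier_vanish_closed:
  assumes C: "closed C"
  shows "(\<integral>w. indicator C w * \<gamma> w \<partial>circle_measure) = 0"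
\<comment> \<open>\<open>infdist\<close> to the empty set is 0 by convention, so there the
  approximating functions would tend to 1.\<close>
proof (cases "C = {}")
  note measurable_\<gamma> [measurable]
  case False
  have [measurable]: "C \<in> sets borel" using C by auto
  define F where "F n w = max 0 (1 - real n * infdist w C)" for n w
  have cF: "continuous_on UNIV (F n)" for n
    unfolding F_def by (intro continuous_intros)
  have [measurable]: "F n \<in> borel_measurable borel" for n
    using cF by (rule borel_measurable_continuous_onI)
  have F1: "\<bar>F n w\<bar> \<le> 1" for n w
    using infdist_nonneg[of w C] by (auto simp: F_def max_def)
  have lim: "(\<lambda>n. F n w) \<longlonglongrightarrow> indicator C w" for w
  proof (cases "w \<in> C")
    case True
    then show ?thesis by (simp add: F_def)
  next
    case w: False
    then have pos: "infdist w C > 0"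
      using infdist_pos_not_in_closed[OF C False] by auto
    then obtain n0 where n0: "1 < real n0 * infdist w C"
      using reals_Archimedean3 by blast
    have "F n w = 0" if "n \<ge> n0" for n
    proof -
      have "real n0 * infdist w C \<le> real n * infdist w C"
        using that pos by (intro mult_right_mono) auto
      then show ?thesis using n0 by (simp add: F_def)
    qed
    then have "\<forall>\<^sub>F n in sequentially. F n w = indicator C w"
      using w by (intro eventually_sequentiallyI[of n0]) auto
    then show ?thesis by (rule tendsto_eventually)
  qed
  have "(\<lambda>n. \<integral>w. complex_of_real (F n w) * \<gamma> w \<partial>circle_measure)
      \<longlonglongrightarrow> (\<integral>w. complex_of_real (indicator C w) * \<gamma> w \<partial>circle_measure)"
  proof (rule integral_dominated_convergence[where w = "\<lambda>w. cmod (\<gamma> w)"])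
    show "AE w in circle_measure. (\<lambda>n. complex_of_real (F n w) * \<gamma> w) \<longlonglongrightarrow> complex_of_real (indicator C w) * \<gamma> w"
      by (intro AE_I2 tendsto_intros lim)
    show "AE w in circle_measure. norm (complex_of_real (F n w) * \<gamma> w) \<le> cmod (\<gamma> w)" for n
      using F1 by (auto simp: norm_mult intro!: AE_I2 mult_left_le_one_le)
  qed (use int in auto)
  then have "(\<integral>w. complex_of_real (indicator C w) * \<gamma> w \<partial>circle_measure) = 0"
    using fourier_vanish_continuous[OF cF] by (simp add: LIMSEQ_const_iff)
  then show ?thesis
    by (simp add: of_real_indicator)
qed simp

text \<open>Dynkin's argument on the intersection-stable generator of closed sets; complements work
  because the total integral, the moment of order 0, vanishes.\<close>

lemma fourier_vanish_borel:
  assumes "A \<in> sets borel"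
  shows "(\<integral>w. indicator A w * \<gamma> w \<partial>circle_measure) = 0"
proof -
  note measurable_\<gamma> [measurable]
  have gen: "sets borel = sigma_sets UNIV {C::complex set. closed C}"
    by (simp add: borel_eq_closed)
  have int_ind: "integrable circle_measure (\<lambda>w. indicator A w * \<gamma> w)" if "A \<in> sets borel" for A
    by (rule integrable_mult_bounded[OF int, where K = 1]) (use that in \<open>auto simp: indicator_def\<close>)
  have "Int_stable {C::complex set. closed C}" "{C::complex set. closed C} \<subseteq> Pow UNIV"
    "A \<in> sigma_sets UNIV {C::complex set. closed C}"
    using assms by (auto simp: gen Int_stable_def)
  then show ?thesis
  proof (induction rule: sigma_sets_induct_disjoint)
    case (compl A)
    then have A: "A \<in> sets borel" by (simp add: gen)
    have "(\<integral>w. indicator (UNIV - A) w * \<gamma> w \<partial>circle_measure)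
        = (\<integral>w. \<gamma> w - indicator A w * \<gamma> w \<partial>circle_measure)"
      by (intro Bochner_Integration.integral_cong) (auto simp: indicator_def)
    also have "\<dots> = (\<integral>w. \<gamma> w \<partial>circle_measure)"
      using compl int int_ind[OF A] by (simp add: Bochner_Integration.integral_diff)
    finally show ?case
      using zero[of 0] by simp
  next
    case (union A)
    then have A: "A i \<in> sets borel" for i
      by (auto simp: gen)
    have "(LINT w:(\<Union>i. A i)|circle_measure. \<gamma> w) = (\<Sum>i. (LINT w:(A i)|circle_measure. \<gamma> w))"
      using union(1) A int_ind[of "\<Union>i. A i"]
      by (intro lebesgue_integral_countable_add)
        (auto simp: disjoint_family_on_def set_integrable_def scaleR_conv_of_real of_real_indicator)
    then show ?case
      using union(3)
      by (simp add: set_lebesgue_integral_def scaleR_conv_of_real of_real_indicator)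
  qed (auto simp: fourier_vanish_closed)
qed

text \<open>For a real-linear h, integrating h \<gamma> over the set where it is positive gives h of
  an integral of \<gamma>, which is 0; so that set is null. Applied to Re, Im and their
  negatives.\<close>

lemma fourier_vanish_AE: "AE w in circle_measure. \<gamma> w = 0"
proof -
  note measurable_\<gamma> [measurable]
  have half: "AE w in circle_measure. \<not> h (\<gamma> w) > 0"
    if "bounded_linear h" for h :: "complex \<Rightarrow> real"
  proof -
    interpret h: bounded_linear h by fact
    have [measurable]: "h \<in> borel_measurable borel"
      using that by (intro borel_measurable_continuous_onI linear_continuous_on)
    define A where "A = {w. h (\<gamma> w) > 0}"
    have A: "A \<in> sets borel"
      unfolding A_def by measurable
    have iA: "integrable circle_measure (\<lambda>w. indicator A w *\<^sub>R \<gamma> w)"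
      using A int by (intro integrable_mult_indicator) auto
    have hA: "h (indicator A w *\<^sub>R \<gamma> w) = indicator A w * h (\<gamma> w)" for w
      by (simp add: h.scaleR)
    have "(\<integral>w. indicator A w * h (\<gamma> w) \<partial>circle_measure) = h (\<integral>w. indicator A w *\<^sub>R \<gamma> w \<partial>circle_measure)"
      using integral_bounded_linear[OF that iA] by (simp add: hA)
    also have "(\<integral>w. indicator A w *\<^sub>R \<gamma> w \<partial>circle_measure) = 0"
      using fourier_vanish_borel[OF A] by (simp add: scaleR_conv_of_real of_real_indicator)
    finally have "(\<integral>w. indicator A w * h (\<gamma> w) \<partial>circle_measure) = 0"
      by (simp add: h.zero)
    moreover have "integrable circle_measure (\<lambda>w. indicator A w * h (\<gamma> w))"
      using integrable_bounded_linear[OF that iA] by (simp add: hA)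
    ultimately have "AE w in circle_measure. indicator A w * h (\<gamma> w) = 0"
      by (subst (asm) integral_nonneg_eq_0_iff_AE) (auto simp: A_def indicator_def)
    then show ?thesis
      by eventually_elim (auto simp: A_def indicator_def)
  qed
  have "AE w in circle_measure. \<not> Re (\<gamma> w) > 0" "AE w in circle_measure. \<not> Im (\<gamma> w) > 0"
    "AE w in circle_measure. \<not> - Re (\<gamma> w) > 0" "AE w in circle_measure. \<not> - Im (\<gamma> w) > 0"
    by (intro half bounded_linear_intros bounded_linear_Re bounded_linear_Im bounded_linear_minus)+
  then show ?thesis
    by eventually_elim (auto simp: complex_eq_iff)
qed

end

section \<open>Complex inner products and Fourier series\<close>

lemma cinner_add_right: "cinner x (y + z) = cinner x y + cinner x z"
  by (metis cinner_add_left cinner_commute complex_cnj_add)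

lemma cinner_scaleC_right: "cinner x (a *\<^sub>C y) = cnj a * cinner x y"
  by (metis cinner_commute cinner_scaleC_left complex_cnj_mult)

lemma cinner_zero_left [simp]: "cinner 0 x = 0"
  using cinner_add_left[of 0 0 x] by simp

lemma cinner_zero_right [simp]: "cinner x 0 = 0"
  using cinner_add_right[of x 0 0] by simp

lemma cinner_minus_left: "cinner (- x) y = - cinner x y"
  using cinner_add_left[of x "- x" y] by (simp add: eq_neg_iff_add_eq_0 add.commute)

lemma cinner_diff_left: "cinner (x - y) z = cinner x z - cinner y z"
  using cinner_add_left[of x "- y" z] by (simp add: cinner_minus_left)

lemma cinner_scaleR_left: "cinner (r *\<^sub>R x) y = complex_of_real r * cinner x y"
  by (metis cinner_scaleC_left scaleC_of_real)

lemma cinner_sum_left: "cinner (\<Sum>i\<in>I. f i) y = (\<Sum>i\<in>I. cinner (f i) y)"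
  by (induction I rule: infinite_finite_induct) (auto simp: cinner_add_left)

lemma cinner_sum_right: "cinner x (\<Sum>i\<in>I. f i) = (\<Sum>i\<in>I. cinner x (f i))"
  by (induction I rule: infinite_finite_induct) (auto simp: cinner_add_right)

lemma cinner_self: "cinner x x = complex_of_real ((norm x)\<^sup>2)"
  using cinner_commute[of x x] by (simp add: complex_eq_iff Re_cinner power2_norm_eq_inner)

lemma norm_scaleC: "norm (a *\<^sub>C x) = cmod a * norm (x :: 'a::complex_inner)"
proof -
  have "complex_of_real ((norm (a *\<^sub>C x))\<^sup>2) = complex_of_real ((cmod a * norm x)\<^sup>2)"
    by (simp only: cinner_self[symmetric] cinner_scaleC_left cinner_scaleC_right)
      (simp add: cinner_self power_mult_distrib complex_norm_square[unfolded of_real_power] mult_ac)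
  then have "(norm (a *\<^sub>C x))\<^sup>2 = (cmod a * norm x)\<^sup>2"
    by (simp only: of_real_eq_iff)
  then show ?thesis
    by (simp add: power2_eq_iff_nonneg)
qed

lemma cmod_cinner_le: "cmod (cinner x y) \<le> norm x * norm y"
proof (cases "cinner x y = 0")
  case False
  \<comment> \<open>The unimodular factor that makes the product of \<open>c *\<^sub>C x\<close>
    with y real and nonnegative, which reduces the claim to the real Cauchy-Schwarz
    inequality.\<close>
  define c where "c = cnj (cinner x y) / cmod (cinner x y)"
  have "cmod (cinner x y) = Re (cinner (c *\<^sub>C x) y)"
    using False
    by (simp add: c_def cinner_scaleC_left mult.commute[of "cnj _"] complex_norm_square[symmetric]
        power2_eq_square)
  also have "\<dots> \<le> norm (c *\<^sub>C x) * norm y"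
    unfolding Re_cinner by (rule norm_cauchy_schwarz)
  also have "\<dots> = norm x * norm y"
    using False by (simp add: norm_scaleC c_def norm_divide)
  finally show ?thesis .
qed simp

lemma bounded_linear_cinner_left: "bounded_linear (\<lambda>x. cinner x y)"
  by (rule bounded_linear_intro[where K = "norm y"])
    (auto simp: cinner_add_left cinner_scaleR_left scaleR_conv_of_real cmod_cinner_le)

lemmas tendsto_cinner_left = bounded_linear.tendsto[OF bounded_linear_cinner_left]

lemma tendsto_cinner_right: "(f \<longlongrightarrow> l) F \<Longrightarrow> ((\<lambda>n. cinner x (f n)) \<longlongrightarrow> cinner x l) F"
  using tendsto_cnj[OF tendsto_cinner_left[of f l F x]] by (simp add: cinner_commute[symmetric])

lemma scaleC_zero_left [simp]: "0 *\<^sub>C (x :: 'a::complex_inner) = 0"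
  using scaleC_of_real[of 0 x] by simp

lemma norm_sum_orthonormal:
  assumes "finite I"
    and "\<And>i j. i \<in> I \<Longrightarrow> j \<in> I \<Longrightarrow> cinner (e i) (e j) = (if i = j then 1 else 0)"
  shows "(norm (\<Sum>i\<in>I. a i *\<^sub>C e i))\<^sup>2 = (\<Sum>i\<in>I. (cmod (a i))\<^sup>2)"
proof -
  have "complex_of_real ((norm (\<Sum>i\<in>I. a i *\<^sub>C e i))\<^sup>2)
      = (\<Sum>j\<in>I. cnj (a j) * (\<Sum>i\<in>I. a i * cinner (e i) (e j)))"
    by (simp only: cinner_self[symmetric] cinner_sum_left cinner_sum_right cinner_scaleC_left
        cinner_scaleC_right)
  also have "\<dots> = (\<Sum>j\<in>I. cnj (a j) * (\<Sum>i\<in>I. if i = j then a i else 0))"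
    using assms(2) by (intro sum.cong arg_cong2[where f = "(*)"] refl) auto
  also have "\<dots> = (\<Sum>j\<in>I. cnj (a j) * a j)"
    using assms(1) by (intro sum.cong refl) simp
  also have "\<dots> = complex_of_real (\<Sum>i\<in>I. (cmod (a i))\<^sup>2)"
    unfolding of_real_sum by (intro sum.cong refl) (simp only: complex_norm_square mult.commute)
  finally show ?thesis
    by (simp only: of_real_eq_iff)
qed

section \<open>Orthonormality and completeness of the powers of z\<close>

lemma integral_circle_measure_power_int:
  "(\<integral>w. w powi k \<partial>circle_measure) = (if k = 0 then 1 else 0)"
proof (cases "k = 0")
  case True
  then show ?thesis
    by (simp add: measure_def emeasure_circle_measure_UNIV)
next
  case False
  define F where "F t = (1 / (\<i> * of_int k)) * cis (of_int k * t)" for t :: real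
  have "(\<integral>w. w powi k \<partial>circle_measure) = (\<integral>t. cis t powi k \<partial>uniform_measure lborel {0..<2 * pi})"
    unfolding circle_measure_def by (rule integral_distr) auto
  also have "\<dots> = (\<integral>t. (indicator {0..<2 * pi} t / (2 * pi)) *\<^sub>R cis t powi k \<partial>lborel)"
  proof -
    have "uniform_measure lborel {0..<2 * pi} = density lborel (\<lambda>t. ennreal (indicator {0..<2 * pi} t / (2 * pi)))"
      unfolding uniform_measure_def
      by (intro density_cong) (auto simp: indicator_def divide_ennreal simp flip: ennreal_1)
    then show ?thesis
      by (simp add: integral_density)
  qed
  \<comment> \<open>Closing the interval costs a null set and brings the integral into the form of
    the fundamental theorem of calculus.\<close>
  also have "\<dots> = (\<integral>t. (1 / (2 * pi)) *\<^sub>R (indicator {0..2 * pi} t *\<^sub>R cis (of_int k * t)) \<partial>lborel)"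
  proof (rule integral_cong_AE)
    show "AE t in lborel. (indicator {0..<2 * pi} t / (2 * pi)) *\<^sub>R cis t powi k
        = (1 / (2 * pi)) *\<^sub>R (indicator {0..2 * pi} t *\<^sub>R cis (of_int k * t))"
      using AE_lborel_singleton[of "2 * pi"]
      by eventually_elim (auto simp: indicator_def cis_power_int)
  qed auto
  also have "\<dots> = (1 / (2 * pi)) *\<^sub>R (\<integral>t. indicator {0..2 * pi} t *\<^sub>R cis (of_int k * t) \<partial>lborel)"
    by (rule integral_scaleR_right)
  also have "(\<integral>t. indicator {0..2 * pi} t *\<^sub>R cis (of_int k * t) \<partial>lborel) = F (2 * pi) - F 0"
  proof (rule integral_FTC_Icc)
    show "(F has_vector_derivative cis (of_int k * t)) (at t within {0..2 * pi})" for t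
    proof -
      have "((\<lambda>t. of_int k * t) has_derivative (\<lambda>h. of_int k * h)) (at t within {0..2 * pi})"
        by (intro derivative_intros)
      from has_derivative_mult_right[OF has_derivative_cis[OF this], of "1 / (\<i> * of_int k)"] show ?thesis
        unfolding F_def has_vector_derivative_def
        by (rule has_derivative_eq_rhs) (use False in \<open>simp add: fun_eq_iff scaleR_conv_of_real field_simps\<close>)
    qed
    show "continuous_on {0..2 * pi} (\<lambda>t. cis (of_int k * t))"
      by (intro continuous_intros)
  qed simp
  also have "\<dots> = 0"
    using cis_multiple_2pi[of "of_int k"] by (simp add: F_def mult.commute mult.left_commute)
  finally show ?thesis
    using False by simp
qed

lemma zpow_def': "zpow n = abs_L2 (\<lambda>w. w powi n)"
  by (simp add: zpow.abs_eq zpow_def)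

lemma fourier_coeff_abs_L2:
  assumes "square_integrable F"
  shows "fourier_coeff (abs_L2 F) n = (\<integral>w. w powi (- n) * F w \<partial>circle_measure)"
proof -
  have [measurable]: "F \<in> borel_measurable circle_measure"
    using assms by (rule square_integrable_measurable)
  have "AE w in circle_measure. F w * cnj (w powi n) = w powi (- n) * F w"
    using AE_circle_measure_norm
  proof eventually_elim
    case (elim w)
    then have "cnj w = inverse w"
      by (metis complex_norm_square inverse_unique of_real_1 power_one)
    then show ?case
      by (simp add: power_int_minus power_int_inverse)
  qed
  then show ?thesis
    unfolding fourier_coeff_def zpow_def' cinner_abs_L2[OF assms square_integrable_power_int]
    by (intro integral_cong_AE) measurable
qed

lemma fourier_coeff_zpow: "fourier_coeff (zpow m) n = (if n = m then 1 else 0)"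
proof -
  have "(\<integral>w. w powi (- n) * w powi m \<partial>circle_measure) = (\<integral>w. w powi (m - n) \<partial>circle_measure)"
  proof (rule integral_cong_AE)
    show "AE w in circle_measure. w powi (- n) * w powi m = w powi (m - n)"
      using AE_circle_measure_norm
    proof eventually_elim
      case (elim w)
      then have "w \<noteq> 0" by auto
      then show ?case
        by (simp add: power_int_add[symmetric])
    qed
  qed measurable
  then show ?thesis
    by (simp add: zpow_def'[of m] fourier_coeff_abs_L2 square_integrable_power_int
        integral_circle_measure_power_int)
qed

lemma fourier_coeff_add: "fourier_coeff (f + g) n = fourier_coeff f n + fourier_coeff g n"
  by (simp add: fourier_coeff_def cinner_add_left)

lemma fourier_coeff_diff: "fourier_coeff (f - g) n = fourier_coeff f n - fourier_coeff g n"
  by (simp add: fourier_coeff_def cinner_diff_left)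

lemma L2_eq_0_if_fourier_coeff_0:
  assumes "\<And>n. fourier_coeff g n = 0"
  shows "g = 0"
proof -
  let ?\<gamma> = "rep_L2 g"
  have sq: "square_integrable (rep_L2 g)"
    by (rule square_integrable_rep_L2)
  have "(\<integral>w. w powi n * ?\<gamma> w \<partial>circle_measure) = 0" for n
    using fourier_coeff_abs_L2[OF sq, of "- n"] assms[of "- n"] by (simp add: abs_rep_L2)
  \<comment> \<open>Pairing with the constant function \<open>w powi 0\<close> shows that a
    square-integrable function is integrable.\<close>
  moreover have "integrable circle_measure ?\<gamma>"
    using integrable_mult_cnj[OF sq square_integrable_power_int[of 0]] by simp
  ultimately have "AE w in circle_measure. ?\<gamma> w = 0"
    by (intro fourier_vanish_AE)
  then have "abs_L2 ?\<gamma> = abs_L2 (\<lambda>_. 0)"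
    by (intro abs_L2_eqI sq square_integrable_zero)
  then show ?thesis
    by (simp add: abs_rep_L2 zero_L2_def)
qed

lemma L2_eqI_fourier_coeff:
  assumes "\<And>n. fourier_coeff f n = fourier_coeff g n"
  shows "f = g"
  using L2_eq_0_if_fourier_coeff_0[of "f - g"] assms by (simp add: fourier_coeff_diff)

lemma fourier_coeff_trig_sum:
  assumes "finite I"
  shows "fourier_coeff (\<Sum>i\<in>I. a i *\<^sub>C zpow i) n = (if n \<in> I then a n else 0)"
proof -
  have "fourier_coeff (\<Sum>i\<in>I. a i *\<^sub>C zpow i) n = (\<Sum>i\<in>I. a i * fourier_coeff (zpow i) n)"
    by (simp add: fourier_coeff_def cinner_sum_left cinner_scaleC_left)
  also have "\<dots> = (\<Sum>i\<in>I. if n = i then a i else 0)"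
    by (intro sum.cong) (auto simp: fourier_coeff_zpow)
  finally show ?thesis
    using assms by simp
qed

lemma cinner_trig_sum_right:
  "cinner g (\<Sum>i\<in>I. a i *\<^sub>C zpow i) = (\<Sum>i\<in>I. cnj (a i) * fourier_coeff g i)"
  by (simp add: cinner_sum_right cinner_scaleC_right fourier_coeff_def)

lemma norm_trig_sum:
  assumes "finite I"
  shows "(norm (\<Sum>i\<in>I. a i *\<^sub>C zpow i))\<^sup>2 = (\<Sum>i\<in>I. (cmod (a i))\<^sup>2)"
  using assms fourier_coeff_zpow by (intro norm_sum_orthonormal) (auto simp: fourier_coeff_def)

section \<open>Bessel's inequality and the Riesz-Fischer theorem\<close>

lemma bessel_L2:
  assumes "finite I"
  shows "(\<Sum>i\<in>I. (cmod (fourier_coeff g i))\<^sup>2) \<le> (norm g)\<^sup>2"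
proof -
  define s where "s = (\<Sum>i\<in>I. fourier_coeff g i *\<^sub>C zpow i)"
  \<comment> \<open>Since <g, s> is the square of the norm of s, Cauchy-Schwarz bounds the norm of s
    by that of g.\<close>
  have "cinner g s = (\<Sum>i\<in>I. complex_of_real ((cmod (fourier_coeff g i))\<^sup>2))"
    unfolding s_def cinner_trig_sum_right
    by (intro sum.cong refl) (simp only: complex_norm_square mult.commute)
  then have "cinner g s = complex_of_real ((norm s)\<^sup>2)"
    unfolding s_def norm_trig_sum[OF assms] of_real_sum .
  then have "(norm s)\<^sup>2 \<le> norm g * norm s"
    using cmod_cinner_le[of g s] by (simp del: of_real_power)
  then have "norm s \<le> norm g"
    by (cases "s = 0") (auto simp: power2_eq_square)
  then have "(norm s)\<^sup>2 \<le> (norm g)\<^sup>2"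
    by (intro power_mono) auto
  then show ?thesis
    by (simp add: s_def norm_trig_sum[OF assms])
qed

text \<open>By orthonormality the squared distance of two partial sums is the difference of two
  terms of a bounded increasing real sequence, so the partial sums are Cauchy.\<close>

lemma trig_series_convergent:
  assumes bound: "\<And>N. (\<Sum>i\<in>{- int N..int N}. (cmod (a i))\<^sup>2) \<le> K"
  obtains g where "(\<lambda>N. \<Sum>i\<in>{- int N..int N}. a i *\<^sub>C zpow i) \<longlonglongrightarrow> g"
    and "\<And>n. fourier_coeff g n = a n"
proof -
  define I where "I N = {- int N..int N}" for N
  define S where "S N = (\<Sum>i\<in>I N. a i *\<^sub>C zpow i)" for N
  define A where "A N = (\<Sum>i\<in>I N. (cmod (a i))\<^sup>2)" for N
  have fin [simp]: "finite (I N)" for N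
    by (simp add: I_def)
  have mono: "I M \<subseteq> I N" if "M \<le> N" for M N
    using that by (auto simp: I_def)
  have dist: "(norm (S N - S M))\<^sup>2 = A N - A M" if "M \<le> N" for M N
    using mono[OF that]
    by (simp add: S_def A_def sum_diff[symmetric] norm_trig_sum)
  have "incseq A"
    unfolding A_def incseq_def by (intro allI impI sum_mono2 mono fin) auto
  moreover have "A N \<le> K" for N
    using bound by (simp add: A_def I_def)
  ultimately have "convergent A"
    by (metis incseq_convergent convergentI)
  then have cA: "Cauchy A"
    by (rule convergent_Cauchy)
  have "Cauchy S"
  proof (rule CauchyI)
    fix e :: real assume e: "e > 0"
    then obtain N where N: "\<And>m n. m \<ge> N \<Longrightarrow> n \<ge> N \<Longrightarrow> norm (A m - A n) < e\<^sup>2"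
      using CauchyD[OF cA, of "e\<^sup>2"] by auto
    have "norm (S m - S n) < e" if "m \<ge> N" "n \<ge> N" "n \<le> m" for m n
      using N[of m n] dist[of n m] that e by (intro power2_less_imp_less[of _ e]) auto
    then have "norm (S m - S n) < e" if "m \<ge> N" "n \<ge> N" for m n
      using that by (metis nle_le norm_minus_commute)
    then show "\<exists>M. \<forall>m\<ge>M. \<forall>n\<ge>M. norm (S m - S n) < e" by blast
  qed
  then obtain g where g: "S \<longlonglongrightarrow> g"
    using L2_complete convergent_def by blast
  have "fourier_coeff g n = a n" for n
  proof (rule LIMSEQ_unique)
    show "(\<lambda>N. fourier_coeff (S N) n) \<longlonglongrightarrow> fourier_coeff g n"
      unfolding fourier_coeff_def by (intro tendsto_cinner_left g)
    show "(\<lambda>N. fourier_coeff (S N) n) \<longlonglongrightarrow> a n"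
      by (intro tendsto_eventually eventually_sequentiallyI[of "nat \<bar>n\<bar>"])
        (auto simp: S_def fourier_coeff_trig_sum I_def)
  qed
  with g that show thesis
    by (simp add: S_def[abs_def] I_def)
qed

text \<open>The series has some limit by Bessel's inequality; the limit has the same coefficients as
  g and hence is g.\<close>

lemma fourier_series_tendsto:
  "(\<lambda>N. \<Sum>i\<in>{- int N..int N}. fourier_coeff g i *\<^sub>C zpow i) \<longlonglongrightarrow> g"
proof -
  obtain h where h: "(\<lambda>N. \<Sum>i\<in>{- int N..int N}. fourier_coeff g i *\<^sub>C zpow i) \<longlonglongrightarrow> h"
    and "\<And>n. fourier_coeff h n = fourier_coeff g n"
    using trig_series_convergent[of "fourier_coeff g" "(norm g)\<^sup>2"] bessel_L2 by blast
  then have "h = g"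
    by (intro L2_eqI_fourier_coeff)
  with h show ?thesis by simp
qed

section \<open>Products in \<open>L\<^sup>2\<close>\<close>

lemma Linf_iff: "\<phi> \<in> Linf \<longleftrightarrow> (\<exists>C. AE w in circle_measure. cmod (rep_L2 \<phi> w) \<le> C)"
  by (simp add: Linf_def ess_bounded.rep_eq)

lemma square_integrable_mult_bounded:
  assumes "F \<in> borel_measurable borel" "AE w in circle_measure. cmod (F w) \<le> C" "square_integrable G"
  shows "square_integrable (\<lambda>w. F w * G w)"
proof -
  have [measurable]: "F \<in> borel_measurable borel" "G \<in> borel_measurable borel"
    using assms square_integrable_measurable[of G] by auto
  have "integrable circle_measure (\<lambda>w. (cmod (F w * G w))\<^sup>2)"
  proof (rule Bochner_Integration.integrable_bound)
    show "integrable circle_measure (\<lambda>w. C\<^sup>2 * (cmod (G w))\<^sup>2)"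
      using assms(3) by (auto simp: square_integrable_def)
    show "AE w in circle_measure. norm ((cmod (F w * G w))\<^sup>2) \<le> norm (C\<^sup>2 * (cmod (G w))\<^sup>2)"
      using assms(2)
      by eventually_elim (auto simp: norm_mult power_mult_distrib intro!: mult_right_mono power_mono)
  qed measurable
  then show ?thesis
    by (simp add: square_integrable_def)
qed

lemma square_integrable_mult_Linf:
  assumes "\<phi> \<in> Linf"
  shows "square_integrable (\<lambda>w. rep_L2 \<phi> w * rep_L2 g w)"
  using assms square_integrable_mult_bounded[OF rep_L2_measurable _ square_integrable_rep_L2]
  by (auto simp: Linf_iff)

lemma cinner_L2_eqI:
  assumes "square_integrable F" "square_integrable F'" "square_integrable G" "square_integrable G'"
    and "AE w in circle_measure. F w * cnj (G w) = F' w * cnj (G' w)"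
  shows "cinner (abs_L2 F) (abs_L2 G) = cinner (abs_L2 F') (abs_L2 G')"
proof -
  have [measurable]: "F \<in> borel_measurable borel" "G \<in> borel_measurable borel"
      "F' \<in> borel_measurable borel" "G' \<in> borel_measurable borel"
    using assms(1-4)[THEN square_integrable_measurable] by auto
  show ?thesis
    unfolding cinner_abs_L2[OF assms(1,3)] cinner_abs_L2[OF assms(2,4)]
    by (rule integral_cong_AE[OF _ _ assms(5)]) measurable
qed

lemma cnj_L2_eq_abs: "cnj_L2 f = abs_L2 (\<lambda>w. cnj (rep_L2 f w))"
  by (simp add: cnj_L2_def)

lemma AE_rep_cnj_L2: "AE w in circle_measure. rep_L2 (cnj_L2 f) w = cnj (rep_L2 f w)"
  unfolding cnj_L2_eq_abs by (intro AE_rep_abs_L2 square_integrable_cnj square_integrable_rep_L2)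

lemma AE_rep_zpow: "AE w in circle_measure. rep_L2 (zpow n) w = w powi n"
  unfolding zpow_def' by (intro AE_rep_abs_L2 square_integrable_power_int)

lemma AE_rep_mult_L2:
  "\<phi> \<in> Linf \<Longrightarrow> AE w in circle_measure. rep_L2 (mult_L2 \<phi> g) w = rep_L2 \<phi> w * rep_L2 g w"
  unfolding mult_L2_def by (intro AE_rep_abs_L2 square_integrable_mult_Linf)

lemma L2_eqI:
  assumes "AE w in circle_measure. rep_L2 f w = rep_L2 g w"
  shows "f = g"
  using abs_L2_eqI[OF square_integrable_rep_L2 square_integrable_rep_L2 assms]
  by (simp add: abs_rep_L2)

lemma mult_L2_commute: "mult_L2 f g = mult_L2 g f"
  by (simp add: mult_L2_def mult.commute)

lemma cnj_L2_in_Linf: "\<phi> \<in> Linf \<Longrightarrow> cnj_L2 \<phi> \<in> Linf"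
proof -
  assume "\<phi> \<in> Linf"
  then obtain C where "AE w in circle_measure. cmod (rep_L2 \<phi> w) \<le> C"
    by (auto simp: Linf_iff)
  then have "AE w in circle_measure. cmod (rep_L2 (cnj_L2 \<phi>) w) \<le> C"
    using AE_rep_cnj_L2[of \<phi>] by eventually_elim simp
  then show ?thesis
    by (auto simp: Linf_iff)
qed

lemma zpow_in_Linf: "zpow n \<in> Linf"
proof -
  have "AE w in circle_measure. cmod (rep_L2 (zpow n) w) \<le> 1"
    using AE_rep_zpow[of n] AE_circle_measure_norm
    by eventually_elim (simp add: norm_power_int)
  then show ?thesis
    by (auto simp: Linf_iff)
qed

lemma cinner_mult_L2_left:
  assumes "\<phi> \<in> Linf"
  shows "cinner (mult_L2 \<phi> g) h = cinner g (mult_L2 (cnj_L2 \<phi>) h)"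
proof -
  have "cinner (abs_L2 (\<lambda>w. rep_L2 \<phi> w * rep_L2 g w)) (abs_L2 (rep_L2 h))
      = cinner (abs_L2 (rep_L2 g)) (abs_L2 (\<lambda>w. rep_L2 (cnj_L2 \<phi>) w * rep_L2 h w))"
  proof (rule cinner_L2_eqI)
    show "AE w in circle_measure. rep_L2 \<phi> w * rep_L2 g w * cnj (rep_L2 h w)
        = rep_L2 g w * cnj (rep_L2 (cnj_L2 \<phi>) w * rep_L2 h w)"
      using AE_rep_cnj_L2[of \<phi>] by eventually_elim simp
  qed (use assms in \<open>auto intro: square_integrable_mult_Linf square_integrable_rep_L2 cnj_L2_in_Linf\<close>)
  then show ?thesis
    by (simp add: mult_L2_def abs_rep_L2)
qed

text \<open>Here g is an arbitrary class. The swap puts p alone into the first slot, where linearity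
  and continuity in p are those of the inner product, without any statement about multiplication by
  g.\<close>

lemma cinner_mult_L2_swap:
  assumes "p \<in> Linf" "q \<in> Linf"
  shows "cinner p (mult_L2 q (cnj_L2 g)) = cinner (mult_L2 p g) q"
proof -
  have "cinner (abs_L2 (rep_L2 p)) (abs_L2 (\<lambda>w. rep_L2 q w * rep_L2 (cnj_L2 g) w))
      = cinner (abs_L2 (\<lambda>w. rep_L2 p w * rep_L2 g w)) (abs_L2 (rep_L2 q))"
  proof (rule cinner_L2_eqI)
    show "AE w in circle_measure. rep_L2 p w * cnj (rep_L2 q w * rep_L2 (cnj_L2 g) w)
        = rep_L2 p w * rep_L2 g w * cnj (rep_L2 q w)"
      using AE_rep_cnj_L2[of g] by eventually_elim simp
  qed (use assms in \<open>auto intro: square_integrable_mult_Linf square_integrable_rep_L2\<close>)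
  then show ?thesis
    by (simp add: mult_L2_def abs_rep_L2)
qed

lemma AE_circle_measure_cnj: "AE w in circle_measure. w \<noteq> 0 \<and> cnj w = inverse w"
  using AE_circle_measure_norm
proof eventually_elim
  case (elim w)
  then show ?case
    by (metis complex_norm_square inverse_unique norm_zero of_real_1 power_one zero_neq_one)
qed

lemma cnj_zpow: "cnj_L2 (zpow n) = zpow (- n)"
proof (rule L2_eqI)
  show "AE w in circle_measure. rep_L2 (cnj_L2 (zpow n)) w = rep_L2 (zpow (- n)) w"
    using AE_rep_cnj_L2[of "zpow n"] AE_rep_zpow[of n] AE_rep_zpow[of "- n"] AE_circle_measure_cnj
    by eventually_elim (simp add: power_int_minus power_int_inverse)
qed

lemma mult_zpow_zpow: "mult_L2 (zpow m) (zpow n) = zpow (m + n)"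
proof (rule L2_eqI)
  show "AE w in circle_measure. rep_L2 (mult_L2 (zpow m) (zpow n)) w = rep_L2 (zpow (m + n)) w"
    using AE_rep_mult_L2[OF zpow_in_Linf, of m "zpow n"] AE_rep_zpow[of m] AE_rep_zpow[of n]
      AE_rep_zpow[of "m + n"] AE_circle_measure_cnj
    by eventually_elim (simp add: power_int_add)
qed

lemma fourier_coeff_mult_zpow: "fourier_coeff (mult_L2 (zpow m) f) n = fourier_coeff f (n - m)"
  by (simp add: fourier_coeff_def cinner_mult_L2_left zpow_in_Linf cnj_zpow mult_zpow_zpow)

lemma cinner_cnj_L2: "cinner (cnj_L2 f) (cnj_L2 g) = cinner g f"
  unfolding cnj_L2_eq_abs
  by (subst cinner_abs_L2)
    (auto intro: square_integrable_cnj square_integrable_rep_L2 simp: cinner_L2_rep mult.commute)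

lemma fourier_coeff_cnj: "fourier_coeff (cnj_L2 f) n = cnj (fourier_coeff f (- n))"
proof -
  have "fourier_coeff (cnj_L2 f) n = cinner (cnj_L2 f) (cnj_L2 (zpow (- n)))"
    by (simp add: fourier_coeff_def cnj_zpow)
  then show ?thesis
    by (simp add: cinner_cnj_L2 fourier_coeff_def cinner_commute[symmetric])
qed

section \<open>Taylor coefficients\<close>

definition hardy_monom :: "nat \<Rightarrow> hardy" where
  "hardy_monom n = Abs_hardy (zpow (int n))"

lemma Rep_hardy_monom: "Rep_hardy (hardy_monom n) = zpow (int n)"
  unfolding hardy_monom_def by (rule Abs_hardy_inverse) (auto simp: H2_def fourier_coeff_zpow)

lemma taylor_coeff_eq_cinner: "taylor_coeff f n = cinner f (hardy_monom n)"
  by (simp add: taylor_coeff_def fourier_coeff_def cinner_hardy.rep_eq Rep_hardy_monom)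

lemma taylor_coeff_monom: "taylor_coeff (hardy_monom m) n = (if m = n then 1 else 0)"
  by (simp add: taylor_coeff_def Rep_hardy_monom fourier_coeff_zpow)

lemma cinner_hardy_monom: "cinner (hardy_monom m) (hardy_monom n) = (if m = n then 1 else 0)"
  using taylor_coeff_monom by (simp add: taylor_coeff_eq_cinner)

lemma fourier_coeff_Rep_hardy:
  "fourier_coeff (Rep_hardy f) i = (if i < 0 then 0 else taylor_coeff f (nat i))"
  using Rep_hardy[of f] by (auto simp: H2_def taylor_coeff_def)

lemma hardy_eqI:
  assumes "\<And>n. taylor_coeff f n = taylor_coeff g n"
  shows "f = g"
  using assms by (intro Rep_hardy_inject[THEN iffD1] L2_eqI_fourier_coeff) (simp add: fourier_coeff_Rep_hardy)

lemma Rep_hardy_sum: "Rep_hardy (\<Sum>i\<in>I. f i) = (\<Sum>i\<in>I. Rep_hardy (f i))"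
  by (induction I rule: infinite_finite_induct) (auto simp: zero_hardy.rep_eq plus_hardy.rep_eq)

lemma tendsto_hardy_iff: "(X \<longlonglongrightarrow> h) \<longleftrightarrow> ((\<lambda>n. Rep_hardy (X n)) \<longlonglongrightarrow> Rep_hardy h)"
  by (simp add: tendsto_iff dist_hardy.rep_eq)

text \<open>Links the symmetric partial sums used for L2 to the one-sided ones of Taylor series. The
  interval up to N corresponds to the first N + 1 terms.\<close>

lemma sum_symmetric_interval:
  fixes N :: nat
  assumes "\<And>i. i < 0 \<Longrightarrow> f i = 0"
  shows "(\<Sum>i\<in>{- int N..int N}. f i) = (\<Sum>n<Suc N. f (int n))"
proof -
  have "(\<Sum>i\<in>{- int N..int N}. f i) = (\<Sum>i\<in>int ` {..<Suc N}. f i)"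
  proof (rule sum.mono_neutral_right)
    show "\<forall>i\<in>{- int N..int N} - int ` {..<Suc N}. f i = 0"
    proof
      fix i assume i: "i \<in> {- int N..int N} - int ` {..<Suc N}"
      have "i < 0"
      proof (rule ccontr)
        assume "\<not> i < 0"
        with i have "i = int (nat i)" "nat i < Suc N" by auto
        then have "i \<in> int ` {..<Suc N}" by blast
        with i show False by blast
      qed
      then show "f i = 0" by (rule assms)
    qed
  qed auto
  also have "\<dots> = (\<Sum>n<Suc N. f (int n))"
    by (simp add: sum.reindex del: sum.lessThan_Suc)
  finally show ?thesis .
qed

lemma Rep_hardy_partial_sum:
  "Rep_hardy (\<Sum>n<N. a n *\<^sub>C hardy_monom n) = (\<Sum>n<N. a n *\<^sub>C zpow (int n))"
  by (simp add: Rep_hardy_sum scaleC_hardy.rep_eq Rep_hardy_monom)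

lemma tendsto_hardy_partial_sums:
  assumes "(\<lambda>N. \<Sum>i\<in>{- int N..int N}. (if i < 0 then 0 else a (nat i)) *\<^sub>C zpow i) \<longlonglongrightarrow> Rep_hardy h"
  shows "(\<lambda>n. a n *\<^sub>C hardy_monom n) sums h"
proof -
  have "(\<lambda>N. Rep_hardy (\<Sum>n<Suc N. a n *\<^sub>C hardy_monom n)) \<longlonglongrightarrow> Rep_hardy h"
    using assms unfolding Rep_hardy_partial_sum
    by (subst (asm) sum_symmetric_interval) (simp_all del: sum.lessThan_Suc)
  then show ?thesis
    unfolding sums_def tendsto_hardy_iff by (rule LIMSEQ_imp_Suc)
qed

lemma hardy_sums: "(\<lambda>n. taylor_coeff f n *\<^sub>C hardy_monom n) sums f"
  using fourier_series_tendsto[of "Rep_hardy f"]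
  by (intro tendsto_hardy_partial_sums) (simp only: fourier_coeff_Rep_hardy)

lemma cinner_hardy_sums: "(\<lambda>n. taylor_coeff f n * cnj (taylor_coeff g n)) sums cinner f g"
proof -
  have "cinner (taylor_coeff f n *\<^sub>C hardy_monom n) g = taylor_coeff f n * cnj (taylor_coeff g n)" for n
    by (simp add: cinner_scaleC_left taylor_coeff_eq_cinner cinner_commute[of "hardy_monom n" g])
  then show ?thesis
    using bounded_linear.sums[OF bounded_linear_cinner_left[of g] hardy_sums[of f]] by simp
qed

lemma bessel_hardy: "(\<Sum>n<N. (cmod (taylor_coeff f n))\<^sup>2) \<le> (norm f)\<^sup>2"
proof -
  have "(\<Sum>n<N. (cmod (taylor_coeff f n))\<^sup>2) = (\<Sum>i\<in>int ` {..<N}. (cmod (fourier_coeff (Rep_hardy f) i))\<^sup>2)"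
    by (simp add: sum.reindex taylor_coeff_def)
  also have "\<dots> \<le> (norm f)\<^sup>2"
    unfolding norm_hardy.rep_eq by (rule bessel_L2) simp
  finally show ?thesis .
qed

text \<open>\<open>hardy_series\<close> is an infinite sum, so its coefficients are known only after
  convergence is. Extended by 0 to negative indices, the sequence falls under the Riesz-Fischer
  theorem, and the limit lies in \<open>H2\<close>.\<close>

lemma taylor_coeff_hardy_series:
  assumes "\<And>N. (\<Sum>n<N. (cmod (a n))\<^sup>2) \<le> K"
  shows "taylor_coeff (hardy_series a) n = a n"
proof -
  define b where "b i = (if i < 0 then 0 else a (nat i))" for i
  have "(\<Sum>i\<in>{- int N..int N}. (cmod (b i))\<^sup>2) \<le> K" for N
    using assms[of "Suc N"] by (subst sum_symmetric_interval) (simp_all add: b_def)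
  then obtain g where g: "(\<lambda>N. \<Sum>i\<in>{- int N..int N}. b i *\<^sub>C zpow i) \<longlonglongrightarrow> g"
    "\<And>i. fourier_coeff g i = b i"
    using trig_series_convergent[of b K] by blast
  have "g \<in> H2"
    by (simp add: H2_def g(2) b_def)
  then have Rep: "Rep_hardy (Abs_hardy g) = g"
    by (rule Abs_hardy_inverse)
  then have "(\<lambda>n. a n *\<^sub>C hardy_monom n) sums Abs_hardy g"
    using g(1) by (intro tendsto_hardy_partial_sums) (simp add: b_def)
  then have "hardy_series a = Abs_hardy g"
    unfolding hardy_series_def hardy_monom_def by (rule sums_unique[symmetric])
  then show ?thesis
    by (simp add: taylor_coeff_def Rep g(2) b_def)
qed

text \<open>The vector described by \<open>hardy_proj\<close> is the Fourier series of g cut off at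
  negative indices. Orthogonality is checked on monomials and passes to limits; uniqueness also
  follows by testing on monomials.\<close>

lemma cinner_hardy_proj: "cinner (hardy_proj g) k = cinner g (Rep_hardy k)"
proof -
  let ?P = "\<lambda>h. \<forall>k. cinner (g - Rep_hardy h) (Rep_hardy k) = 0"
  define h where "h = hardy_series (\<lambda>n. fourier_coeff g (int n))"
  have bound: "(\<Sum>n<N. (cmod (fourier_coeff g (int n)))\<^sup>2) \<le> (norm g)\<^sup>2" for N
    using bessel_L2[of "int ` {..<N}" g] by (simp add: sum.reindex)
  have th: "taylor_coeff h n = fourier_coeff g (int n)" for n
    unfolding h_def by (rule taylor_coeff_hardy_series[OF bound])
  have "?P h"
  proof
    fix k
    define s where "s N = (\<Sum>n<N. taylor_coeff k n *\<^sub>C zpow (int n))" for N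
    have "s \<longlonglongrightarrow> Rep_hardy k"
      using hardy_sums[of k] unfolding sums_def tendsto_hardy_iff Rep_hardy_partial_sum s_def .
    then have "(\<lambda>N. cinner (g - Rep_hardy h) (s N)) \<longlonglongrightarrow> cinner (g - Rep_hardy h) (Rep_hardy k)"
      by (rule tendsto_cinner_right)
    moreover have "cinner (g - Rep_hardy h) (s N) = 0" for N
      using th by (simp add: s_def cinner_sum_right cinner_scaleC_right cinner_diff_left
          taylor_coeff_def fourier_coeff_def)
    ultimately show "cinner (g - Rep_hardy h) (Rep_hardy k) = 0"
      by (simp add: LIMSEQ_const_iff)
  qed
  moreover have "h' = h" if "?P h'" for h'
  proof (rule hardy_eqI)
    fix n
    have "cinner (g - Rep_hardy h') (Rep_hardy (hardy_monom n)) = 0"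
      using that by blast
    then show "taylor_coeff h' n = taylor_coeff h n"
      using th[of n] by (simp add: cinner_diff_left Rep_hardy_monom taylor_coeff_def fourier_coeff_def)
  qed
  ultimately have "?P (hardy_proj g)"
    unfolding hardy_proj_def by (rule theI)
  then show ?thesis
    by (simp add: cinner_diff_left cinner_hardy.rep_eq)
qed

section \<open>Adjoints and matrix entries\<close>

text \<open>\<open>cadjoint\<close> is a choice that is meaningful only once some witness exists;
  the relation lets witnesses be exhibited, composed and reversed independently of that
  choice.\<close>

definition is_cadjoint :: "('a::complex_inner \<Rightarrow> 'b::complex_inner) \<Rightarrow> ('b \<Rightarrow> 'a) \<Rightarrow> bool" where
  "is_cadjoint A B \<longleftrightarrow> (\<forall>x y. cinner (A x) y = cinner x (B y))"

lemma is_cadjointD: "is_cadjoint A B \<Longrightarrow> cinner (A x) y = cinner x (B y)"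
  by (simp add: is_cadjoint_def)

lemma is_cadjoint_sym: "is_cadjoint A B \<Longrightarrow> is_cadjoint B A"
  by (metis cinner_commute is_cadjoint_def)

lemma is_cadjoint_comp: "is_cadjoint A A' \<Longrightarrow> is_cadjoint B B' \<Longrightarrow> is_cadjoint (A \<circ> B) (B' \<circ> A')"
  by (simp add: is_cadjoint_def)

lemma is_cadjoint_cadjoint:
  assumes "is_cadjoint A B"
  shows "is_cadjoint A (cadjoint A)"
proof -
  have "\<exists>B. \<forall>x y. cinner (A x) y = cinner x (B y)"
    using assms by (auto simp: is_cadjoint_def)
  then show ?thesis
    unfolding cadjoint_def is_cadjoint_def by (rule someI_ex)
qed

lemma is_cadjoint_block_op:
  assumes "is_cadjoint A A'" "is_cadjoint B B'" "is_cadjoint C C'" "is_cadjoint D D'"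
  shows "is_cadjoint (block_op A B C D) (block_op A' C' B' D')"
  using assms by (auto simp: is_cadjoint_def block_op_def cinner_prod_def cinner_add_left cinner_add_right)

lemma is_cadjoint_zero: "is_cadjoint (\<lambda>_. 0) (\<lambda>_. 0)"
  by (simp add: is_cadjoint_def)

text \<open>Coefficient j of A x is <x, A' z^j>, and the coefficients of A' z^j are conjugates of
  matrix entries of A. Continuity and linearity are thus replaced by the existence of an
  adjoint.\<close>

lemma is_cadjoint_eqI_matrix:
  fixes A B :: "hardy \<Rightarrow> hardy"
  assumes A: "is_cadjoint A A'" and B: "is_cadjoint B B'"
    and eq: "\<And>i j. cinner (A (hardy_monom i)) (hardy_monom j) = cinner (B (hardy_monom i)) (hardy_monom j)"
  shows "A = B"
proof
  fix x
  have "A' (hardy_monom j) = B' (hardy_monom j)" for j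
  proof (rule hardy_eqI)
    fix i
    have "cinner (hardy_monom i) (A' (hardy_monom j)) = cinner (hardy_monom i) (B' (hardy_monom j))"
      using eq[of i j] by (simp add: is_cadjointD[OF A] is_cadjointD[OF B])
    then show "taylor_coeff (A' (hardy_monom j)) i = taylor_coeff (B' (hardy_monom j)) i"
      by (metis taylor_coeff_eq_cinner cinner_commute)
  qed
  then show "A x = B x"
    by (intro hardy_eqI) (simp add: taylor_coeff_eq_cinner is_cadjointD[OF A] is_cadjointD[OF B])
qed

section \<open>Adjoints and entries of Toeplitz operators, the shift and bounded operators\<close>

lemma is_cadjoint_toeplitz:
  assumes "\<phi> \<in> Linf"
  shows "is_cadjoint (toeplitz \<phi>) (toeplitz (cnj_L2 \<phi>))"
  unfolding is_cadjoint_def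
proof (intro allI)
  fix x y
  have "cinner (toeplitz \<phi> x) y = cinner (Rep_hardy x) (mult_L2 (cnj_L2 \<phi>) (Rep_hardy y))"
    by (simp add: toeplitz_def cinner_hardy_proj cinner_mult_L2_left assms)
  also have "\<dots> = cnj (cinner (toeplitz (cnj_L2 \<phi>) y) x)"
    by (simp add: toeplitz_def cinner_hardy_proj cinner_commute[symmetric])
  finally show "cinner (toeplitz \<phi> x) y = cinner x (toeplitz (cnj_L2 \<phi>) y)"
    by (simp add: cinner_commute[symmetric])
qed

lemma taylor_coeff_toeplitz:
  "taylor_coeff (toeplitz \<phi> h) n = fourier_coeff (mult_L2 \<phi> (Rep_hardy h)) (int n)"
  by (simp add: taylor_coeff_eq_cinner toeplitz_def cinner_hardy_proj Rep_hardy_monom fourier_coeff_def)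

text \<open>The monomial is the bounded factor of the product, so for an arbitrary class \<phi> it
  can be moved in front, where it merely translates the coefficients.\<close>

lemma toeplitz_matrix:
  "cinner (toeplitz \<phi> (hardy_monom i)) (hardy_monom j) = fourier_coeff \<phi> (int j - int i)"
  by (simp add: taylor_coeff_eq_cinner[symmetric] taylor_coeff_toeplitz Rep_hardy_monom
      mult_L2_commute[of \<phi>] fourier_coeff_mult_zpow)

lemma taylor_coeff_shift: "taylor_coeff (shift h) n = (case n of 0 \<Rightarrow> 0 | Suc m \<Rightarrow> taylor_coeff h m)"
  by (auto simp: shift_def taylor_coeff_toeplitz fourier_coeff_mult_zpow fourier_coeff_Rep_hardy
      nat_diff_distrib split: nat.split)

lemma shift_monom: "shift (hardy_monom n) = hardy_monom (Suc n)"
  by (rule hardy_eqI) (auto simp: taylor_coeff_shift taylor_coeff_monom split: nat.split)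

text \<open>The adjoint of X at y must have coefficients <y, X z^n>. It remains to see that these
  are square-summable.\<close>

lemma bounded_clinear_is_cadjoint:
  fixes X :: "hardy \<Rightarrow> hardy"
  assumes "bounded_clinear X"
  shows "is_cadjoint X (cadjoint X)"
proof -
  interpret X: bounded_linear X
    using assms by (simp add: bounded_clinear_def)
  have XC: "X (c *\<^sub>C x) = c *\<^sub>C X x" for c x
    using assms by (simp add: bounded_clinear_def)
  obtain K where K: "\<And>x. norm (X x) \<le> norm x * K"
    using X.bounded by blast
  define c where "c y n = cinner y (X (hardy_monom n))" for y n
  have "(\<Sum>n<N. (cmod (c y n))\<^sup>2) \<le> (norm y * K)\<^sup>2" for y N
  proof -
    \<comment> \<open>Testing y on X v with the coefficients themselves as weights gives norm v ^ 2
      = <y, X v> <= norm y * K * norm v, and norm v cancels.\<close>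
    define v where "v = (\<Sum>n<N. c y n *\<^sub>C hardy_monom n)"
    define s where "s = (\<Sum>n<N. (cmod (c y n))\<^sup>2)"
    have nv: "(norm v)\<^sup>2 = s"
      unfolding v_def s_def by (intro norm_sum_orthonormal) (auto simp: cinner_hardy_monom)
    have "cinner y (X v) = (\<Sum>n<N. cnj (c y n) * c y n)"
      by (simp add: v_def X.sum XC cinner_sum_right cinner_scaleC_right c_def)
    also have "\<dots> = complex_of_real s"
      unfolding s_def of_real_sum by (intro sum.cong refl) (simp only: complex_norm_square mult.commute)
    finally have "cmod (cinner y (X v)) = \<bar>s\<bar>"
      by (simp only: norm_of_real)
    then have "s \<le> norm y * norm (X v)"
      using cmod_cinner_le[of y "X v"] by linarith
    also have "\<dots> \<le> norm y * (norm v * K)"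
      by (intro mult_left_mono K) auto
    finally have "(norm v)\<^sup>2 \<le> (norm y * K) * norm v"
      by (simp add: nv mult_ac)
    then have "norm v \<le> norm y * K \<or> norm v = 0"
      by (auto simp: power2_eq_square)
    then have "(norm v)\<^sup>2 \<le> (norm y * K)\<^sup>2"
      by (auto intro: power_mono)
    then show ?thesis
      by (simp add: nv s_def)
  qed
  then have tc: "taylor_coeff (hardy_series (c y)) n = c y n" for y n
    by (rule taylor_coeff_hardy_series)
  have "is_cadjoint X (\<lambda>y. hardy_series (c y))"
    unfolding is_cadjoint_def
  proof (intro allI)
    fix x y
    have "cinner (X (taylor_coeff x n *\<^sub>C hardy_monom n)) y = taylor_coeff x n * cnj (c y n)" for n
      by (simp add: XC cinner_scaleC_left c_def cinner_commute[of "X (hardy_monom n)" y])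
    then have "(\<lambda>n. taylor_coeff x n * cnj (c y n)) sums cinner (X x) y"
      using bounded_linear.sums[OF bounded_linear_cinner_left[of y] X.sums[OF hardy_sums[of x]]] by simp
    moreover have "(\<lambda>n. taylor_coeff x n * cnj (c y n)) sums cinner x (hardy_series (c y))"
      using cinner_hardy_sums[of x "hardy_series (c y)"] by (simp add: tc)
    ultimately show "cinner (X x) y = cinner x (hardy_series (c y))"
      by (rule sums_unique2)
  qed
  then show ?thesis
    by (rule is_cadjoint_cadjoint)
qed

section \<open>Boundedness of Toeplitz symbols\<close>

lemma add_in_Linf:
  assumes "f \<in> Linf" "g \<in> Linf"
  shows "f + g \<in> Linf"
proof -
  obtain C D where C: "AE w in circle_measure. cmod (rep_L2 f w) \<le> C"
    and D: "AE w in circle_measure. cmod (rep_L2 g w) \<le> D"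
    using assms by (auto simp: Linf_iff)
  have "f + g = abs_L2 (\<lambda>w. rep_L2 f w + rep_L2 g w)"
    by (simp add: plus_L2_def)
  then have "AE w in circle_measure. rep_L2 (f + g) w = rep_L2 f w + rep_L2 g w"
    by (simp add: AE_rep_abs_L2 square_integrable_add square_integrable_rep_L2)
  then have "AE w in circle_measure. cmod (rep_L2 (f + g) w) \<le> C + D"
    using C D by eventually_elim (metis add_mono norm_triangle_ineq order_trans)
  then show ?thesis
    by (auto simp: Linf_iff)
qed

lemma scaleC_in_Linf:
  assumes "f \<in> Linf"
  shows "c *\<^sub>C f \<in> Linf"
proof -
  obtain C where C: "AE w in circle_measure. cmod (rep_L2 f w) \<le> C"
    using assms by (auto simp: Linf_iff)
  have "c *\<^sub>C f = abs_L2 (\<lambda>w. c * rep_L2 f w)"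
    by (simp add: scaleC_L2_def)
  then have "AE w in circle_measure. rep_L2 (c *\<^sub>C f) w = c * rep_L2 f w"
    by (simp add: AE_rep_abs_L2 square_integrable_scale square_integrable_rep_L2)
  then have "AE w in circle_measure. cmod (rep_L2 (c *\<^sub>C f) w) \<le> cmod c * C"
    using C by eventually_elim (simp add: norm_mult mult_left_mono)
  then show ?thesis
    by (auto simp: Linf_iff)
qed

lemma zero_in_Linf: "0 \<in> Linf"
  using scaleC_in_Linf[OF zpow_in_Linf, of 0 0] by simp

lemma trig_sum_in_Linf: "(\<Sum>i\<in>I. a i *\<^sub>C zpow i) \<in> Linf"
  by (induction I rule: infinite_finite_induct)
    (auto intro: zero_in_Linf add_in_Linf scaleC_in_Linf zpow_in_Linf)

text \<open>Writes the form <g p, q> through the Toeplitz matrix of g, the side on which it can be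
  compared with the operator.\<close>

lemma cinner_mult_trig_sums:
  "cinner (mult_L2 (\<Sum>i\<in>I. p i *\<^sub>C zpow i) g) (\<Sum>j\<in>J. q j *\<^sub>C zpow j)
    = (\<Sum>j\<in>J. cnj (q j) * (\<Sum>i\<in>I. p i * fourier_coeff g (j - i)))"
proof -
  have "cinner (mult_L2 (\<Sum>i\<in>I. p i *\<^sub>C zpow i) g) (zpow j) = (\<Sum>i\<in>I. p i * fourier_coeff g (j - i))" for j
  proof -
    have "cinner (mult_L2 (\<Sum>i\<in>I. p i *\<^sub>C zpow i) g) (zpow j)
        = (\<Sum>i\<in>I. p i * cinner (zpow i) (mult_L2 (zpow j) (cnj_L2 g)))"
      by (simp add: cinner_mult_L2_swap[symmetric] trig_sum_in_Linf zpow_in_Linf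
          cinner_sum_left cinner_scaleC_left)
    then show ?thesis
      by (simp add: cinner_mult_L2_swap zpow_in_Linf fourier_coeff_def[symmetric] fourier_coeff_mult_zpow)
  qed
  then show ?thesis
    by (simp add: cinner_sum_right cinner_scaleC_right)
qed

text \<open>Tested on the indicator of the set where g exceeds M in modulus, the bound says that
  |g|^2 - M^2 has integral at most 0 there, though it is positive; so the set is null.\<close>

lemma in_Linf_if_mult_bounded:
  assumes "M \<ge> 0" and bound: "\<And>h. h \<in> Linf \<Longrightarrow> norm (mult_L2 h g) \<le> M * norm h"
  shows "g \<in> Linf"
proof -
  define A where "A = {w. cmod (rep_L2 g w) > M}"
  have A [measurable]: "A \<in> sets borel"
    unfolding A_def by measurable
  define F :: "complex \<Rightarrow> complex" where "F = indicator A"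
  have F [measurable]: "F \<in> borel_measurable borel"
    unfolding F_def by measurable
  define h where "h = abs_L2 F"
  have "AE w in circle_measure. cmod (F w) \<le> 1"
    by (simp add: F_def indicator_def)
  then have "square_integrable F"
    using square_integrable_mult_bounded[OF F _ square_integrable_power_int[of 0]] by simp
  then have h: "AE w in circle_measure. rep_L2 h w = F w"
    unfolding h_def by (rule AE_rep_abs_L2)
  then have "AE w in circle_measure. cmod (rep_L2 h w) \<le> 1"
    by eventually_elim (simp add: F_def indicator_def)
  then have hL: "h \<in> Linf"
    by (auto simp: Linf_iff)
  define d where "d w = M\<^sup>2 * (cmod (rep_L2 h w))\<^sup>2 - (cmod (rep_L2 (mult_L2 h g) w))\<^sup>2" for w
  have int: "integrable circle_measure (\<lambda>w. (cmod (rep_L2 f w))\<^sup>2)" for f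
    using square_integrable_rep_L2[of f] by (simp add: square_integrable_def)
  have d_int: "integrable circle_measure (\<lambda>w. - d w)"
    unfolding d_def by (intro Bochner_Integration.integrable_minus Bochner_Integration.integrable_diff
        integrable_mult_right int)
  have d: "AE w in circle_measure. - d w = indicator A w * ((cmod (rep_L2 g w))\<^sup>2 - M\<^sup>2)"
    using h AE_rep_mult_L2[OF hL, of g]
    by eventually_elim (simp add: d_def F_def indicator_def)
  have pos: "indicator A w * ((cmod (rep_L2 g w))\<^sup>2 - M\<^sup>2) \<ge> 0" for w
    using assms(1) by (auto simp: A_def indicator_def intro!: power_mono)
  have "(\<integral>w. - d w \<partial>circle_measure) = (norm (mult_L2 h g))\<^sup>2 - M\<^sup>2 * (norm h)\<^sup>2"
    unfolding d_def norm_L2_power2 by (simp add: int Bochner_Integration.integral_diff)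
  also have "\<dots> \<le> 0"
    using power_mono[OF bound[OF hL], of 2] by (simp add: power_mult_distrib)
  finally have "(\<integral>w. - d w \<partial>circle_measure) \<le> 0" .
  moreover have nonneg: "AE w in circle_measure. 0 \<le> - d w"
    using d by eventually_elim (use pos in simp)
  ultimately have "(\<integral>w. - d w \<partial>circle_measure) = 0"
    using integral_nonneg_AE by (metis order_antisym)
  then have "AE w in circle_measure. - d w = 0"
    using integral_nonneg_eq_0_iff_AE[OF d_int nonneg] by simp
  then have "AE w in circle_measure. cmod (rep_L2 g w) \<le> M"
    using d
  proof eventually_elim
    case (elim w)
    show ?case
    proof (rule ccontr)
      assume "\<not> cmod (rep_L2 g w) \<le> M"
      then have "w \<in> A" "M\<^sup>2 < (cmod (rep_L2 g w))\<^sup>2"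
        using assms(1) by (auto simp: A_def intro!: power_strict_mono)
      then show False
        using elim by simp
    qed
  qed
  then show ?thesis
    by (auto simp: Linf_iff)
qed

text \<open>The Brown--Halmos argument: multiplication by a power of \<open>z\<close> moves two trigonometric
  polynomials into the Hardy space without changing their norms, so the form
  \<open>\<langle>g p, q\<rangle>\<close> inherits the bound of the operator.\<close>

lemma Linf_if_toeplitz_matrix:
  assumes X: "bounded_clinear X" and "inj \<alpha>" "inj \<beta>"
    and matrix: "\<And>i j. cinner (X (hardy_monom (\<alpha> i))) (hardy_monom (\<beta> j)) = fourier_coeff g (int j - int i)"
  shows "g \<in> Linf"
proof -
  interpret X: bounded_linear X
    using X by (simp add: bounded_clinear_def)
  have XC: "X (c *\<^sub>C x) = c *\<^sub>C X x" for c x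
    using X by (simp add: bounded_clinear_def)
  obtain M where M: "M \<ge> 0" "\<And>x. norm (X x) \<le> norm x * M"
    using X.nonneg_bounded by blast
  define I where "I N = {- int N..int N}" for N
  have fin [simp]: "finite (I N)" for N
    by (simp add: I_def)
  define trig where "trig a N = (\<Sum>i\<in>I N. a i *\<^sub>C zpow i)" for a N
  have trig_Linf: "trig a N \<in> Linf" for a N
    by (simp add: trig_def trig_sum_in_Linf)
  have trig_lim: "(\<lambda>N. trig (fourier_coeff h) N) \<longlonglongrightarrow> h" for h
    using fourier_series_tendsto[of h] by (simp add: trig_def I_def)
  have step1: "cmod (cinner (mult_L2 (trig p N) g) (trig q N)) \<le> M * norm (trig p N) * norm (trig q N)" for p q N
  proof -
    \<comment> \<open>Adding N makes all exponents natural and leaves the differences j - i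
      unchanged. The injections \<alpha> and \<beta> then spread the coefficients over distinct
      monomials, which preserves norms.\<close>
    define lift where "lift \<gamma> a = (\<Sum>i\<in>I N. a i *\<^sub>C hardy_monom (\<gamma> (nat (i + int N))))"
      for \<gamma> :: "nat \<Rightarrow> nat" and a
    have norm_lift: "norm (lift \<gamma> a) = norm (trig a N)" if "inj \<gamma>" for \<gamma> a
    proof -
      have "(norm (lift \<gamma> a))\<^sup>2 = (norm (trig a N))\<^sup>2"
        unfolding lift_def trig_def norm_trig_sum[OF fin]
        by (intro norm_sum_orthonormal fin)
          (use that in \<open>auto simp: cinner_hardy_monom I_def dest!: injD\<close>)
      then show ?thesis
        by (simp add: power2_eq_iff_nonneg)
    qed
    have "cinner (X (lift \<alpha> p)) (lift \<beta> q) = cinner (mult_L2 (trig p N) g) (trig q N)"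
      unfolding trig_def cinner_mult_trig_sums
      by (auto simp: lift_def X.sum XC cinner_sum_left cinner_sum_right cinner_scaleC_left
          cinner_scaleC_right matrix I_def intro!: sum.cong)
    then have "cmod (cinner (mult_L2 (trig p N) g) (trig q N)) \<le> norm (X (lift \<alpha> p)) * norm (lift \<beta> q)"
      using cmod_cinner_le[of "X (lift \<alpha> p)" "lift \<beta> q"] by simp
    also have "\<dots> \<le> norm (lift \<alpha> p) * M * norm (lift \<beta> q)"
      by (intro mult_right_mono M) auto
    finally show ?thesis
      by (simp add: norm_lift assms mult_ac)
  qed
  \<comment> \<open>From polynomials to every h in L2: with g in the second slot, the factor
    \<open>mult_L2 (trig q K) (cnj_L2 g)\<close> is a fixed vector, so the form is continuous in
    h.\<close>
  have step2: "cmod (cinner h (mult_L2 (trig q K) (cnj_L2 g))) \<le> M * norm h * norm (trig q K)" for h q K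
  proof (rule LIMSEQ_le)
    let ?s = "\<lambda>N. trig (fourier_coeff h) N"
    show "(\<lambda>N. cmod (cinner (?s N) (mult_L2 (trig q K) (cnj_L2 g))))
        \<longlonglongrightarrow> cmod (cinner h (mult_L2 (trig q K) (cnj_L2 g)))"
      by (intro tendsto_intros tendsto_cinner_left trig_lim)
    show "(\<lambda>N. M * norm (?s N) * norm (trig q K)) \<longlonglongrightarrow> M * norm h * norm (trig q K)"
      by (intro tendsto_intros trig_lim)
    have "cmod (cinner (?s N) (mult_L2 (trig q K) (cnj_L2 g))) \<le> M * norm (?s N) * norm (trig q K)"
      if "N \<ge> K" for N
    proof -
      \<comment> \<open>K stays fixed while N grows, so q is padded with zeros to reach the common
        index set of the previous bound.\<close>
      have "trig q K = trig (\<lambda>i. if i \<in> I K then q i else 0) N"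
        unfolding trig_def using that by (intro sum.mono_neutral_cong_left) (auto simp: I_def)
      then show ?thesis
        using step1[of "fourier_coeff h" N "\<lambda>i. if i \<in> I K then q i else 0"]
        by (simp add: cinner_mult_L2_swap trig_Linf)
    qed
    then show "\<exists>N. \<forall>n\<ge>N. cmod (cinner (?s n) (mult_L2 (trig q K) (cnj_L2 g))) \<le> M * norm (?s n) * norm (trig q K)"
      by blast
  qed
  \<comment> \<open>For h in \<open>Linf\<close> the product with g is a genuine L2 vector, so k can
    now be approximated. Choosing k to be that product then yields the operator bound.\<close>
  have step3: "cmod (cinner (mult_L2 h g) k) \<le> M * norm h * norm k" if h: "h \<in> Linf" for h k
  proof (rule LIMSEQ_le)
    let ?t = "\<lambda>N. trig (fourier_coeff k) N"
    show "(\<lambda>N. cmod (cinner (mult_L2 h g) (?t N))) \<longlonglongrightarrow> cmod (cinner (mult_L2 h g) k)"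
      by (intro tendsto_intros tendsto_cinner_right trig_lim)
    show "(\<lambda>N. M * norm h * norm (?t N)) \<longlonglongrightarrow> M * norm h * norm k"
      by (intro tendsto_intros trig_lim)
    show "\<exists>N. \<forall>n\<ge>N. cmod (cinner (mult_L2 h g) (?t n)) \<le> M * norm h * norm (?t n)"
      using step2 by (auto simp: cinner_mult_L2_swap[OF h trig_Linf, symmetric])
  qed
  have "norm (mult_L2 h g) \<le> M * norm h" if "h \<in> Linf" for h
  proof -
    have "(norm (mult_L2 h g))\<^sup>2 \<le> M * norm h * norm (mult_L2 h g)"
      using step3[OF that, of "mult_L2 h g"] by (simp add: cinner_self norm_power)
    then show ?thesis
      using M(1) by (cases "mult_L2 h g = 0") (auto simp: power2_eq_square)
  qed
  with M(1) show ?thesis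
    by (rule in_Linf_if_mult_bounded)
qed

section \<open>The even--odd decomposition\<close>

lemma sum_lessThan_double:
  fixes f :: "nat \<Rightarrow> 'a::comm_monoid_add"
  shows "(\<Sum>n<2 * N. f n) = (\<Sum>n<N. f (2 * n) + f (2 * n + 1))"
  by (induction N) (auto simp: add_ac)

text \<open>Splitting the first 2 N coefficients by parity bounds both subsequences by the norm of
  f, which makes both series converge.\<close>

lemma taylor_coeff_even_odd:
  "taylor_coeff (fst (even_odd f)) n = taylor_coeff f (2 * n)"
  "taylor_coeff (snd (even_odd f)) n = taylor_coeff f (2 * n + 1)"
proof -
  have "(\<Sum>n<N. (cmod (taylor_coeff f (2 * n)))\<^sup>2) + (\<Sum>n<N. (cmod (taylor_coeff f (2 * n + 1)))\<^sup>2)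
      \<le> (norm f)\<^sup>2" for N
    using bessel_hardy[where N = "2 * N"] by (simp only: sum_lessThan_double sum.distrib)
  moreover have "(\<Sum>n<N. (cmod (taylor_coeff f (c n)))\<^sup>2) \<ge> 0" for N and c :: "nat \<Rightarrow> nat"
    by (intro sum_nonneg) simp
  ultimately have "(\<Sum>n<N. (cmod (taylor_coeff f (2 * n)))\<^sup>2) \<le> (norm f)\<^sup>2"
    "(\<Sum>n<N. (cmod (taylor_coeff f (2 * n + 1)))\<^sup>2) \<le> (norm f)\<^sup>2" for N
    by (meson add_increasing add_increasing2 order_trans order_refl)+
  then show "taylor_coeff (fst (even_odd f)) n = taylor_coeff f (2 * n)"
    "taylor_coeff (snd (even_odd f)) n = taylor_coeff f (2 * n + 1)"
    unfolding even_odd_def fst_conv snd_conv by (intro taylor_coeff_hardy_series; blast)+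
qed

lemma is_cadjoint_even_odd: "is_cadjoint even_odd (cadjoint even_odd)"
proof -
  \<comment> \<open>Interleaving the two coefficient sequences: the inverse of the unitary
    \<open>even_odd\<close>, which serves as its adjoint.\<close>
  define a where "a p n = (if even n then taylor_coeff (fst p) (n div 2) else taylor_coeff (snd p) (n div 2))"
    for p and n :: nat
  have "(\<Sum>n<N. (cmod (a p n))\<^sup>2) \<le> (norm (fst p))\<^sup>2 + (norm (snd p))\<^sup>2" for p N
  proof -
    have "(\<Sum>n<N. (cmod (a p n))\<^sup>2) \<le> (\<Sum>n<2 * N. (cmod (a p n))\<^sup>2)"
      by (intro sum_mono2) auto
    also have "\<dots> = (\<Sum>n<N. (cmod (taylor_coeff (fst p) n))\<^sup>2) + (\<Sum>n<N. (cmod (taylor_coeff (snd p) n))\<^sup>2)"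
      unfolding sum_lessThan_double by (simp add: a_def sum.distrib)
    finally show ?thesis
      using bessel_hardy[of "fst p" N] bessel_hardy[of "snd p" N] by linarith
  qed
  then have ta: "taylor_coeff (hardy_series (a p)) n = a p n" for p n
    by (rule taylor_coeff_hardy_series)
  have "is_cadjoint even_odd (\<lambda>p. hardy_series (a p))"
    unfolding is_cadjoint_def
  proof (intro allI)
    fix f p
    define c where "c n = taylor_coeff f n * cnj (a p n)" for n
    have "c sums cinner f (hardy_series (a p))"
      using cinner_hardy_sums[of f "hardy_series (a p)"] by (simp add: ta c_def[abs_def])
    \<comment> \<open>Passing to partial sums of even length lets the terms be grouped in
      pairs.\<close>
    then have "(\<lambda>N. \<Sum>n<2 * N. c n) \<longlonglongrightarrow> cinner f (hardy_series (a p))"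
      unfolding sums_def by (rule filterlim_compose) (auto intro: filterlim_subseq simp: strict_mono_def)
    then have "(\<lambda>n. c (2 * n) + c (2 * n + 1)) sums cinner f (hardy_series (a p))"
      unfolding sum_lessThan_double sums_def .
    moreover have "(\<lambda>n. c (2 * n) + c (2 * n + 1)) sums cinner (even_odd f) p"
      using sums_add[OF cinner_hardy_sums[of "fst (even_odd f)" "fst p"] cinner_hardy_sums[of "snd (even_odd f)" "snd p"]]
      by (simp add: taylor_coeff_even_odd c_def a_def cinner_prod_def)
    ultimately show "cinner (even_odd f) p = cinner f (hardy_series (a p))"
      by (rule sums_unique2[rotated])
  qed
  then show ?thesis
    by (rule is_cadjoint_cadjoint)
qed

lemma taylor_coeff_0: "taylor_coeff 0 n = 0"
  by (simp add: taylor_coeff_eq_cinner)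

lemma even_odd_monom:
  "even_odd (hardy_monom (2 * n)) = (hardy_monom n, 0)"
  "even_odd (hardy_monom (Suc (2 * n))) = (0, hardy_monom n)"
proof -
  have "2 * n \<noteq> Suc (2 * m)" "Suc (2 * m) \<noteq> 2 * n" for m n by presburger+
  then show "even_odd (hardy_monom (2 * n)) = (hardy_monom n, 0)"
    "even_odd (hardy_monom (Suc (2 * n))) = (0, hardy_monom n)"
    by (intro prod_eqI hardy_eqI; simp add: taylor_coeff_even_odd taylor_coeff_monom taylor_coeff_0)+
qed

section \<open>The operator equation\<close>

text \<open>Both conditions come from one matrix identity. The left-hand entry at (i, j) is x(i, j -
  1), or 0 if j = 0; the right-hand one is the conjugate of x(j, i + 1). The case j = 0 is the
  vanishing condition.\<close>

lemma shift_eq_iff_matrix: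
  assumes X: "is_cadjoint X (cadjoint X)"
  shows "shift \<circ> X = cadjoint X \<circ> shift \<longleftrightarrow>
    (\<forall>i j. cinner (X (hardy_monom i)) (hardy_monom j)
        = cnj (cinner (X (hardy_monom (Suc j))) (hardy_monom (Suc i)))) \<and>
    (\<forall>i. cinner (X (hardy_monom 0)) (hardy_monom (Suc i)) = 0)"
    (is "?eq \<longleftrightarrow> ?M \<and> ?Z")
proof -
  let ?L = "\<lambda>i j. cinner ((shift \<circ> X) (hardy_monom i)) (hardy_monom j)"
  let ?R = "\<lambda>i j. cinner ((cadjoint X \<circ> shift) (hardy_monom i)) (hardy_monom j)"
  have S: "is_cadjoint shift (toeplitz (cnj_L2 (zpow 1)))"
    unfolding shift_def by (rule is_cadjoint_toeplitz[OF zpow_in_Linf])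
  have L: "?L i 0 = 0" "?L i (Suc j) = cinner (X (hardy_monom i)) (hardy_monom j)" for i j
    by (simp_all add: taylor_coeff_eq_cinner[symmetric] taylor_coeff_shift)
  have R: "?R i j = cnj (cinner (X (hardy_monom j)) (hardy_monom (Suc i)))" for i j
    by (simp add: shift_monom is_cadjointD[OF is_cadjoint_sym[OF X]] cinner_commute[symmetric])
  have "?eq \<longleftrightarrow> (\<forall>i j. ?L i j = ?R i j)"
    using is_cadjoint_eqI_matrix[OF is_cadjoint_comp[OF S X] is_cadjoint_comp[OF is_cadjoint_sym[OF X] S]]
    by metis
  also have "\<dots> \<longleftrightarrow> (\<forall>i. ?L i 0 = ?R i 0) \<and> (\<forall>i j. ?L i (Suc j) = ?R i (Suc j))"
    by (metis not0_implies_Suc)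
  also have "\<dots> \<longleftrightarrow> ?M \<and> ?Z"
    unfolding L R by auto
  finally show ?thesis .
qed

text \<open>Moving \<open>cadjoint even_odd\<close> across the inner product leaves the block
  operator between images of monomials. These have one zero component, so each parity class of
  entries sees exactly one block.\<close>

lemma matrix_even_odd_block_op:
  assumes "\<phi> \<in> Linf" and \<psi>: "\<psi> \<in> Linf"
  defines "Y \<equiv> cadjoint even_odd \<circ> block_op (cadjoint (toeplitz \<phi>)) (toeplitz \<psi>) (\<lambda>_. 0) (toeplitz \<phi>) \<circ> even_odd"
  shows "\<exists>Y'. is_cadjoint Y Y'"
    and "cinner (Y (hardy_monom (2 * i))) (hardy_monom (2 * j)) = cnj (fourier_coeff \<phi> (int i - int j))"
    and "cinner (Y (hardy_monom (2 * i))) (hardy_monom (Suc (2 * j))) = 0"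
    and "cinner (Y (hardy_monom (Suc (2 * i)))) (hardy_monom (2 * j)) = fourier_coeff \<psi> (int j - int i)"
    and "cinner (Y (hardy_monom (Suc (2 * i)))) (hardy_monom (Suc (2 * j))) = fourier_coeff \<phi> (int j - int i)"
proof -
  have T: "is_cadjoint (toeplitz \<phi>) (cadjoint (toeplitz \<phi>))"
    by (rule is_cadjoint_cadjoint[OF is_cadjoint_toeplitz[OF assms(1)]])
  have T': "is_cadjoint (cadjoint (toeplitz \<phi>)) (toeplitz \<phi>)"
    by (rule is_cadjoint_sym[OF T])
  have U: "is_cadjoint (cadjoint even_odd) even_odd"
    by (rule is_cadjoint_sym[OF is_cadjoint_even_odd])
  show "\<exists>Y'. is_cadjoint Y Y'"
    unfolding Y_def
    using is_cadjoint_comp[OF is_cadjoint_comp[OF U is_cadjoint_block_op[OF T' is_cadjoint_toeplitz[OF \<psi>]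
            is_cadjoint_zero T]] is_cadjoint_even_odd] by blast
  \<comment> \<open>The blocks meet the zero components of \<open>even_odd_monom\<close>; their
    values at 0 follow from the adjoint pairs alone.\<close>
  have z: "cadjoint (toeplitz \<phi>) 0 = 0" "toeplitz \<phi> 0 = 0" "toeplitz \<psi> 0 = 0"
    by (rule hardy_eqI; simp add: taylor_coeff_eq_cinner is_cadjointD[OF T'] is_cadjointD[OF T]
        is_cadjointD[OF is_cadjoint_toeplitz[OF \<psi>]])+
  have Y: "cinner (Y x) y = cinner (block_op (cadjoint (toeplitz \<phi>)) (toeplitz \<psi>) (\<lambda>_. 0) (toeplitz \<phi>)
      (even_odd x)) (even_odd y)" for x y
    by (simp add: Y_def is_cadjointD[OF U])
  have "cinner (cadjoint (toeplitz \<phi>) (hardy_monom i)) (hardy_monom j) = cnj (fourier_coeff \<phi> (int i - int j))"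
    by (simp add: is_cadjointD[OF T'] cinner_commute[of "hardy_monom i"] toeplitz_matrix)
  then show "cinner (Y (hardy_monom (2 * i))) (hardy_monom (2 * j)) = cnj (fourier_coeff \<phi> (int i - int j))"
    "cinner (Y (hardy_monom (2 * i))) (hardy_monom (Suc (2 * j))) = 0"
    "cinner (Y (hardy_monom (Suc (2 * i)))) (hardy_monom (2 * j)) = fourier_coeff \<psi> (int j - int i)"
    "cinner (Y (hardy_monom (Suc (2 * i)))) (hardy_monom (Suc (2 * j))) = fourier_coeff \<phi> (int j - int i)"
    by (simp_all add: Y even_odd_monom block_op_def cinner_prod_def z toeplitz_matrix)
qed

lemma double_cases:
  fixes n :: nat
  obtains m where "n = 2 * m" | m where "n = Suc (2 * m)"
  by (metis evenE oddE Suc_eq_plus1)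

theorem theorem3p2:
  fixes X :: "hardy \<Rightarrow> hardy"
  assumes "bounded_clinear X"
  shows "shift \<circ> X = cadjoint X \<circ> shift \<longleftrightarrow>
    (\<exists>\<phi>\<^sub>2\<^sub>2\<in>Hinf. \<exists>f\<in>H2. cnj_L2 f + mult_L2 (zpow 1) f \<in> Linf \<and>
      X = cadjoint even_odd \<circ>
          block_op (cadjoint (toeplitz \<phi>\<^sub>2\<^sub>2)) (toeplitz (cnj_L2 f + mult_L2 (zpow 1) f))
                   (\<lambda>_. 0)                   (toeplitz \<phi>\<^sub>2\<^sub>2)
          \<circ> even_odd)"
    (is "_ \<longleftrightarrow> ?rhs")
proof -
  note adj = bounded_clinear_is_cadjoint[OF assms]
  define x where "x i j = cinner (X (hardy_monom i)) (hardy_monom j)" for i j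
  have coeff_\<psi>: "fourier_coeff (cnj_L2 f + mult_L2 (zpow 1) f) n
      = cnj (fourier_coeff f (- n)) + fourier_coeff f (n - 1)" for f n
    by (simp add: fourier_coeff_add fourier_coeff_cnj fourier_coeff_mult_zpow)
  have "?rhs" if eq: "shift \<circ> X = cadjoint X \<circ> shift"
  proof -
    have M: "x i j = cnj (x (Suc j) (Suc i))" and Z: "x 0 (Suc i) = 0" for i j
      using eq unfolding shift_eq_iff_matrix[OF adj] x_def by blast+
    have M2: "x (i + 2 * k) (j + 2 * k) = x i j" for i j k
    proof (induction k)
      case (Suc k)
      have "x (i + 2 * k) (j + 2 * k) = x (Suc (Suc (i + 2 * k))) (Suc (Suc (j + 2 * k)))"
        by (metis M complex_cnj_cnj)
      with Suc show ?case by simp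
    qed simp
    define \<phi> where "\<phi> = Rep_hardy (snd (even_odd (X (hardy_monom 1))))"
    \<comment> \<open>\<open>toeplitz (zpow (- 1))\<close> is the backward shift. It drops the
      constant term of X z, so the odd part of the result has coefficients x(1, 2), x(1, 4), and so
      on; the factor z in z f puts them back at degrees 1, 2, and so on.\<close>
    define f where "f = Rep_hardy (snd (even_odd (toeplitz (zpow (- 1)) (X (hardy_monom 1)))))"
    let ?\<psi> = "cnj_L2 f + mult_L2 (zpow 1) f"
    have H2: "\<phi> \<in> H2" "f \<in> H2"
      unfolding \<phi>_def f_def by (rule Rep_hardy)+
    have c\<phi>: "fourier_coeff \<phi> n = (if n < 0 then 0 else x 1 (2 * nat n + 1))" for n
      by (simp add: \<phi>_def fourier_coeff_Rep_hardy taylor_coeff_even_odd)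
        (simp add: taylor_coeff_eq_cinner x_def)
    have cf: "fourier_coeff f n = (if n < 0 then 0 else x 1 (2 * nat n + 2))" for n
    proof -
      have "taylor_coeff (toeplitz (zpow (- 1)) h) m = taylor_coeff h (Suc m)" for h m
        by (simp add: taylor_coeff_toeplitz fourier_coeff_mult_zpow fourier_coeff_Rep_hardy nat_add_distrib)
      then show ?thesis
        by (simp add: f_def fourier_coeff_Rep_hardy taylor_coeff_even_odd)
          (simp add: taylor_coeff_eq_cinner x_def)
    qed
    have odd_odd: "x (Suc (2 * i)) (Suc (2 * j)) = fourier_coeff \<phi> (int j - int i)" for i j
    proof (cases "i \<le> j")
      case True
      then obtain k where "j = i + k"
        using le_Suc_ex by blast
      then show ?thesis
        using M2[of 1 i "Suc (2 * k)"] by (simp add: c\<phi> algebra_simps)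
    next
      case False
      then obtain k where k: "i = Suc (j + k)"
        using less_imp_Suc_add not_le by blast
      \<comment> \<open>The period leads back to first index 0, where i > j makes the second index
        positive and \<open>Z\<close> applies.\<close>
      have "x (2 * j) (2 * i) = 0"
        using M2[of 0 j "Suc (Suc (2 * k))"] Z by (simp add: k algebra_simps)
      then have "x (Suc (2 * i)) (Suc (2 * j)) = 0"
        using M[of "2 * j" "2 * i"] by simp
      then show ?thesis
        using k by (simp add: c\<phi>)
    qed
    have even_even: "x (2 * i) (2 * j) = cnj (fourier_coeff \<phi> (int i - int j))" for i j
      by (subst M) (simp only: odd_odd)
    have odd_even: "x (Suc (2 * i)) (2 * j) = fourier_coeff ?\<psi> (int j - int i)" for i j
    \<comment> \<open>In degrees n >= 1 only z f contributes to the symbol, in degrees n <= 0 only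
      the conjugate of f. In the second case \<open>M\<close> turns the difference j - i into 1 - (j
      - i) >= 1.\<close>
    proof (cases "i < j")
      case True
      then obtain k where "j = Suc (i + k)"
        using less_imp_Suc_add by blast
      then show ?thesis
        using M2[of 1 i "Suc (Suc (2 * k))"] by (simp add: coeff_\<psi> cf algebra_simps)
    next
      case False
      then obtain k where k: "i = j + k"
        using le_Suc_ex not_less by blast
      have "x (Suc (2 * i)) (2 * j) = cnj (x (Suc (2 * j)) (Suc (Suc (2 * i))))"
        by (rule M)
      also have "x (Suc (2 * j)) (Suc (Suc (2 * i))) = x 1 (Suc (Suc (2 * k)))"
        using M2[of 1 j "Suc (Suc (2 * k))"] by (simp add: k algebra_simps)
      finally show ?thesis
        by (simp add: coeff_\<psi> cf k)
    qed
    have even_odd_entry: "x (2 * i) (Suc (2 * j)) = 0" for i j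
    proof (cases "i \<le> j")
      case True
      then obtain k where "j = i + k"
        using le_Suc_ex by blast
      then show ?thesis
        using M2[of 0 i "Suc (2 * k)"] by (simp add: Z algebra_simps)
    next
      case False
      then obtain k where k: "i = Suc (j + k)"
        using less_imp_Suc_add not_le by blast
      \<comment> \<open>\<open>M\<close> keeps the even-odd parity but makes the second index the
        larger one, so the period again leads back to first index 0.\<close>
      have "x (2 * i) (Suc (2 * j)) = cnj (x (Suc (Suc (2 * j))) (Suc (2 * i)))"
        by (rule M)
      also have "x (Suc (Suc (2 * j))) (Suc (2 * i)) = 0"
        using M2[of 0 "Suc j" "Suc (2 * k)"] Z by (simp add: k algebra_simps)
      finally show ?thesis by simp
    qed
    \<comment> \<open>Odd inputs with odd outputs, and below odd inputs with even outputs, select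
      genuine Toeplitz matrices inside the matrix of the bounded operator X.\<close>
    have \<phi>: "\<phi> \<in> Linf"
      by (rule Linf_if_toeplitz_matrix[OF assms, of "\<lambda>i. Suc (2 * i)" "\<lambda>j. Suc (2 * j)"])
        (auto simp: inj_on_def odd_odd[unfolded x_def])
    have \<psi>: "?\<psi> \<in> Linf"
      by (rule Linf_if_toeplitz_matrix[OF assms, of "\<lambda>i. Suc (2 * i)" "\<lambda>j. 2 * j"])
        (auto simp: inj_on_def odd_even[unfolded x_def])
    note Y = matrix_even_odd_block_op[OF \<phi> \<psi>]
    obtain Y' where Y': "is_cadjoint (cadjoint even_odd \<circ>
        block_op (cadjoint (toeplitz \<phi>)) (toeplitz ?\<psi>) (\<lambda>_. 0) (toeplitz \<phi>) \<circ> even_odd) Y'"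
      using Y(1) by blast
    have "X = cadjoint even_odd \<circ>
        block_op (cadjoint (toeplitz \<phi>)) (toeplitz ?\<psi>) (\<lambda>_. 0) (toeplitz \<phi>) \<circ> even_odd"
    proof (rule is_cadjoint_eqI_matrix[OF adj Y'])
      fix i j
      show "cinner (X (hardy_monom i)) (hardy_monom j) = cinner ((cadjoint even_odd \<circ>
        block_op (cadjoint (toeplitz \<phi>)) (toeplitz ?\<psi>) (\<lambda>_. 0) (toeplitz \<phi>) \<circ> even_odd) (hardy_monom i)) (hardy_monom j)"
        by (cases i rule: double_cases; cases j rule: double_cases;
            simp only: Y(2-) odd_odd[unfolded x_def] even_even[unfolded x_def] odd_even[unfolded x_def] even_odd_entry[unfolded x_def])
    qed
    with H2 \<phi> \<psi> show ?thesis
      unfolding Hinf_def by blast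
  qed
  moreover have "shift \<circ> X = cadjoint X \<circ> shift" if ?rhs
  proof -
    obtain \<phi> f where H2: "\<phi> \<in> H2" and \<phi>: "\<phi> \<in> Linf" and \<psi>: "cnj_L2 f + mult_L2 (zpow 1) f \<in> Linf"
      and X: "X = cadjoint even_odd \<circ> block_op (cadjoint (toeplitz \<phi>))
        (toeplitz (cnj_L2 f + mult_L2 (zpow 1) f)) (\<lambda>_. 0) (toeplitz \<phi>) \<circ> even_odd"
      using \<open>?rhs\<close> unfolding Hinf_def by blast
    note Y = matrix_even_odd_block_op(2-)[OF \<phi> \<psi>, folded X, folded x_def]
    have "x i j = cnj (x (Suc j) (Suc i))" for i j
    proof -
      \<comment> \<open>Raising both indices flips both parities; twice-raised even indices are
        rewritten as doubles so that the table \<open>Y\<close> applies.\<close>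
      have d: "Suc (Suc (2 * n)) = 2 * Suc n" for n by simp
      show ?thesis
        by (cases i rule: double_cases; cases j rule: double_cases; simp only: d Y; simp add: coeff_\<psi> algebra_simps)
    qed
    moreover have "x 0 (Suc j) = 0" for j
    \<comment> \<open>An even positive index meets a coefficient of \<phi> of negative degree, which
      vanishes since \<phi> is in \<open>H2\<close>; an odd one meets the zero block.\<close>
    proof (cases "Suc j" rule: double_cases)
      case (1 m)
      then have "x 0 (Suc j) = cnj (fourier_coeff \<phi> (- int m))" "m > 0"
        using Y(1)[of 0 m] by auto
      then show ?thesis
        using H2 by (simp add: H2_def)
    next
      case (2 m)
      then show ?thesis
        using Y(2)[of 0 m] by simp
    qed
    ultimately show ?thesis
      unfolding shift_eq_iff_matrix[OF adj] x_def by blast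
  qed
  ultimately show ?thesis by blast
qed

end
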